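(* Let $K$ be a strictly convex domain in $\mathbb R^2$ whose boundary $\partial K$ is an oval, of area $A_{\partial K}$ and perimeter $L_{\partial K}$, let $\widetilde{A}_{\mathrm{CWMS}(\partial K)}$ be the oriented area of the Constant Width Measure Set of $\partial K$, and let $S_K$ be the Steiner symmetral of $K$. Then $$L_{\partial K}^2-4\pi A_{\partial K}-\pi\left|\widetilde{A}_{\mathrm{CWMS}(\partial K)}\right|\geqslant 16\pi\, d_{2}^2(K,S_K),$$ where equality holds if and only if $\partial K$ is centrally symmetric or the Minkowski support function of $\partial K$ is of the form $$p_{\partial K}(\theta)=a_0+a_1\cos\theta+b_1\sin\theta+a_3\cos3\theta+b_3\sin3\theta+\sum_{\substack{n=2,\\ n\text{ even}}}^{\infty}(a_n\cos n\theta+b_n\sin n\theta).$$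
   Context: An oval is a $C^\infty$ regular simple closed convex planar curve (signed curvature nowhere zero, of constant sign); orient ovals positively. For an oval $M$ with an origin inside and Minkowski support function $p_M(\theta)$, $M$ is parameterized by $\gamma(\theta)=(p_M\cos\theta-p_M'\sin\theta,\ p_M\sin\theta+p_M'\cos\theta)$. Parallel pairs (ordered pairs of distinct points with parallel tangent lines) are $\gamma(\theta),\gamma(\theta+\pi)$. Constant Width Measure Set: $\mathrm{CWMS}(M)=\{a-b+\frac{L_M}{\pi}\mathbf n(a): a,b\text{ a parallel pair of }M\}$, with $L_M$ the length of $M$ and $\mathbf n(\gamma(\theta))=-(\cos\theta,\sin\theta)$ the unit normal; it is parameterized by $\gamma(\theta)-\gamma(\theta+\pi)+\frac{L_M}{\pi}\mathbf n(\gamma(\theta))$, $\theta\in[0,2\pi]$. The oriented area of an oriented closed curve $C$ is $\widetilde A_C=\frac12\int_C -y\,dx+x\,dy$ (zero if $C$ is a point). The Steiner point of $K$ is $\vec s(K)=\frac1\pi\int_0^{2\pi}(\cos\theta,\sin\theta)\,p_{\partial K}(\theta)\,d\theta$. The Steiner symmetral $S_K$ is the centrally symmetric convex body $\frac12(K+(-K))$ (Minkowski addition, $-K=\{-k:k\in K\}$), translated so that its center is the Steiner point of $K$. Its support function is $p_{\partial S_K}(\theta)=\langle\vec s(K),(\cos\theta,\sin\theta)\rangle+\frac12(p_{\partial K}(\theta)+p_{\partial K}(\theta+\pi))$. $d_2(K,N)=\left(\int_0^{2\pi}|p_{\partial K}(\theta)-p_{\partial N}(\theta)|^2d\theta\right)^{1/2}$.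 *)

theory Defs
  imports "HOL-Analysis.Analysis"
begin

type_synonym plane = "real \<times> real"

definition det2 :: "plane \<Rightarrow> plane \<Rightarrow> real" where
  "det2 v w = fst v * snd w - snd v * fst w"

definition rot90 :: "plane \<Rightarrow> plane" where
  "rot90 v = (- snd v, fst v)"

definition unit_vec :: "real \<Rightarrow> plane" where
  "unit_vec \<theta> = (cos \<theta>, sin \<theta>)"

definition vderiv :: "(real \<Rightarrow> plane) \<Rightarrow> real \<Rightarrow> plane" where
  "vderiv c t = vector_derivative c (at t)"

definition smooth_curve :: "(real \<Rightarrow> plane) \<Rightarrow> bool" where
  "smooth_curve c \<longleftrightarrow> (\<forall>n t. (vderiv ^^ n) c differentiable (at t))"

definition curvature :: "(real \<Rightarrow> plane) \<Rightarrow> real \<Rightarrow> real" where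
  "curvature c t = det2 (vderiv c t) (vderiv (vderiv c) t) / norm (vderiv c t) ^ 3"

text \<open>
  A closed curve is a 1-periodic function on the reals, so that it also closes up smoothly.
  Of the two constant signs that the curvature of an oval can have, the positive one is the
  counterclockwise orientation.
\<close>

definition oval :: "(real \<Rightarrow> plane) \<Rightarrow> bool" where
  "oval \<gamma> \<longleftrightarrow>
     smooth_curve \<gamma> \<and> (\<forall>t. \<gamma> (t + 1) = \<gamma> t) \<and> simple_path \<gamma> \<and>
     (\<forall>t. vderiv \<gamma> t \<noteq> 0) \<and> (\<forall>t. curvature \<gamma> t > 0)"

definition curve_length :: "(real \<Rightarrow> plane) \<Rightarrow> real" where
  "curve_length \<gamma> = integral {0..1} (\<lambda>t. norm (vderiv \<gamma> t))"

definition strictly_convex_domain :: "plane set \<Rightarrow> bool" where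
  "strictly_convex_domain K \<longleftrightarrow>
     compact K \<and> convex K \<and> interior K \<noteq> {} \<and>
     (\<forall>x\<in>K. \<forall>y\<in>K. x \<noteq> y \<longrightarrow> open_segment x y \<subseteq> interior K)"

text \<open>
  A convex body and its boundary have the same support function; as in the classical notation,
  the definitions below apply it to the boundary curve.
\<close>

definition supp_fun :: "plane set \<Rightarrow> real \<Rightarrow> real" where
  "supp_fun M \<theta> = (SUP x\<in>M. x \<bullet> unit_vec \<theta>)"

definition supp_param :: "plane set \<Rightarrow> real \<Rightarrow> plane" where
  "supp_param M \<theta> =
     (let p = supp_fun M \<theta>; p' = deriv (supp_fun M) \<theta>
      in (p * cos \<theta> - p' * sin \<theta>, p * sin \<theta> + p' * cos \<theta>))"

text \<open>
  Points of the oval are addressed by their parameters.  On a counterclockwise oval the unit normal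
  below is the inward one, i.e. \<open>- unit_vec \<theta>\<close> at the point with outer normal angle \<open>\<theta>\<close>.
\<close>

definition parallel_pair :: "(real \<Rightarrow> plane) \<Rightarrow> real \<Rightarrow> real \<Rightarrow> bool" where
  "parallel_pair \<gamma> s t \<longleftrightarrow> \<gamma> s \<noteq> \<gamma> t \<and> det2 (vderiv \<gamma> s) (vderiv \<gamma> t) = 0"

definition unit_normal :: "(real \<Rightarrow> plane) \<Rightarrow> real \<Rightarrow> plane" where
  "unit_normal \<gamma> t = rot90 (vderiv \<gamma> t) /\<^sub>R norm (vderiv \<gamma> t)"

definition CWMS :: "(real \<Rightarrow> plane) \<Rightarrow> plane set" where
  "CWMS \<gamma> = {\<gamma> s - \<gamma> t + (curve_length \<gamma> / pi) *\<^sub>R unit_normal \<gamma> s | s t. parallel_pair \<gamma> s t}"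

text \<open>
  The oriented area depends on how the set is traversed; the traversal is the one by the
  normal angle.  Lemma \<open>CWMS_eq_image\<close> below shows that it runs through exactly the set above.
\<close>

definition CWMS_param :: "(real \<Rightarrow> plane) \<Rightarrow> real \<Rightarrow> plane" where
  "CWMS_param \<gamma> \<theta> =
     supp_param (path_image \<gamma>) \<theta> - supp_param (path_image \<gamma>) (\<theta> + pi)
       + (curve_length \<gamma> / pi) *\<^sub>R (- unit_vec \<theta>)"

definition oriented_area :: "(real \<Rightarrow> plane) \<Rightarrow> real \<Rightarrow> real \<Rightarrow> real" where
  "oriented_area c a b =
     (1/2) * integral {a..b} (\<lambda>t. - snd (c t) * fst (vderiv c t) + fst (c t) * snd (vderiv c t))"

definition CWMS_area :: "(real \<Rightarrow> plane) \<Rightarrow> real" where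
  "CWMS_area \<gamma> = oriented_area (CWMS_param \<gamma>) 0 (2 * pi)"

definition steiner_point :: "plane set \<Rightarrow> plane" where
  "steiner_point K =
     (1 / pi) *\<^sub>R integral {0..2 * pi} (\<lambda>\<theta>. supp_fun (frontier K) \<theta> *\<^sub>R unit_vec \<theta>)"

text \<open>The body \<open>1/2 (K + (-K))\<close> is centred at the origin, so it is translated by the Steiner point.\<close>

definition steiner_symmetral :: "plane set \<Rightarrow> plane set" where
  "steiner_symmetral K = {steiner_point K + (1/2) *\<^sub>R (x + - y) | x y. x \<in> K \<and> y \<in> K}"

definition d2 :: "plane set \<Rightarrow> plane set \<Rightarrow> real" where
  "d2 K N = sqrt (integral {0..2 * pi}
     (\<lambda>\<theta>. \<bar>supp_fun (frontier K) \<theta> - supp_fun (frontier N) \<theta>\<bar>\<^sup>2))"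

definition centrally_symmetric :: "plane set \<Rightarrow> bool" where
  "centrally_symmetric M \<longleftrightarrow> (\<exists>c. (\<lambda>x. 2 *\<^sub>R c - x) ` M = M)"


subsection \<open>The normal-angle traversal of the Constant Width Measure Set\<close>

lemma unit_vec_minus: "unit_vec (\<theta> + pi) = - unit_vec \<theta>"
  by (simp add: unit_vec_def)

lemma pyth: "r * (cos \<theta> * cos \<theta>) + r * (sin \<theta> * sin \<theta>) = (r::real)"
  using sin_cos_squared_add3[of \<theta>] by (simp flip: distrib_left)

lemma unit_vec_nz [simp]: "unit_vec \<theta> \<noteq> 0"
proof -
  have "norm (unit_vec \<theta>) = 1" by (simp add: unit_vec_def norm_Pair)
  then show ?thesis by force
qed

lemma unit_vec_exhaust:
  assumes "a \<noteq> (0::plane)"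
  obtains \<theta> where "0 \<le> \<theta>" "\<theta> < 2 * pi" "a = norm a *\<^sub>R unit_vec \<theta>"
proof -
  have n: "norm a > 0" using assms by simp
  have "(fst a / norm a)\<^sup>2 + (snd a / norm a)\<^sup>2 = ((fst a)\<^sup>2 + (snd a)\<^sup>2) / (norm a)\<^sup>2"
    by (simp add: power_divide add_divide_distrib)
  also have "(fst a)\<^sup>2 + (snd a)\<^sup>2 = (norm a)\<^sup>2"
    by (cases a) (simp add: norm_Pair)
  finally have "(fst a / norm a)\<^sup>2 + (snd a / norm a)\<^sup>2 = 1" using n by simp
  then obtain t where "0 \<le> t" "t < 2 * pi" "fst a / norm a = cos t" "snd a / norm a = sin t"
    using sincos_total_2pi by blast
  moreover from this have "fst a = norm a * cos t" "snd a = norm a * sin t"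
    using n by (simp_all add: field_simps)
  then have "a = norm a *\<^sub>R unit_vec t" unfolding prod_eq_iff unit_vec_def by simp
  ultimately show thesis using that by blast
qed

lemma interior_not_max:
  assumes "z \<in> interior K" "u \<noteq> (0::plane)"
  obtains w where "w \<in> K" "z \<bullet> u < w \<bullet> u"
proof -
  obtain e where e: "e > 0" "ball z e \<subseteq> K"
    using assms(1) mem_interior by blast
  define w where "w = z + (e / (2 * norm u)) *\<^sub>R u"
  have "dist z w = e / 2" using assms(2) e(1) by (simp add: w_def dist_norm)
  then have "w \<in> ball z e" using e(1) by simp
  then have "w \<in> K" using e(2) by blast
  moreover have "z \<bullet> u < w \<bullet> u"
    using assms(2) e(1) by (simp add: w_def inner_add_left)
  ultimately show thesis by (rule that)
qed

definition is_support_pt :: "plane set \<Rightarrow> real \<Rightarrow> plane \<Rightarrow> bool" where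
  "is_support_pt K \<theta> x \<longleftrightarrow> x \<in> K \<and> (\<forall>y\<in>K. y \<bullet> unit_vec \<theta> \<le> x \<bullet> unit_vec \<theta>)"

context
  fixes K :: "plane set"
  assumes K: "strictly_convex_domain K"
begin

lemma K_facts: "compact K" "convex K" "interior K \<noteq> {}" "K \<noteq> {}" "closed K"
  using K interior_subset by (auto simp: strictly_convex_domain_def compact_imp_closed)

lemma is_support_pt_ex: "\<exists>x. is_support_pt K \<theta> x"
proof -
  have "continuous_on K (\<lambda>x. x \<bullet> unit_vec \<theta>)" by (intro continuous_intros)
  from continuous_attains_sup[OF K_facts(1) K_facts(4) this]
  show ?thesis unfolding is_support_pt_def by blast
qed

lemma is_support_pt_frontier: "is_support_pt K \<theta> x \<Longrightarrow> x \<in> frontier K"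
  using interior_not_max[of x K "unit_vec \<theta>"] K_facts(5)
  unfolding is_support_pt_def frontier_def closure_closed[OF K_facts(5)]
  by (metis DiffI not_le unit_vec_nz)

lemma is_support_pt_unique:
  assumes "is_support_pt K \<theta> x" "is_support_pt K \<theta> y"
  shows "x = y"
proof (rule ccontr)
  assume ne: "x \<noteq> y"
  have "x \<in> K" "y \<in> K" using assms by (simp_all add: is_support_pt_def)
  then have "open_segment x y \<subseteq> interior K"
    using K ne unfolding strictly_convex_domain_def by blast
  then have "midpoint x y \<in> interior K"
    using ne by (meson midpoint_in_open_segment subsetD)
  then obtain w where w: "w \<in> K" "midpoint x y \<bullet> unit_vec \<theta> < w \<bullet> unit_vec \<theta>"
    using interior_not_max[OF _ unit_vec_nz] by metis
  have "x \<bullet> unit_vec \<theta> = y \<bullet> unit_vec \<theta>"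
    using assms unfolding is_support_pt_def by (meson order.antisym)
  then have "midpoint x y \<bullet> unit_vec \<theta> = x \<bullet> unit_vec \<theta>"
    by (simp add: midpoint_def inner_add_left)
  then show False using w assms(1) by (auto simp: is_support_pt_def)
qed

definition support_pt :: "real \<Rightarrow> plane" where "support_pt \<theta> = (THE x. is_support_pt K \<theta> x)"

lemma support_pt: "is_support_pt K \<theta> (support_pt \<theta>)"
  unfolding support_pt_def using is_support_pt_ex is_support_pt_unique by (metis theI)

lemma support_pt_eqI: "is_support_pt K \<theta> x \<Longrightarrow> support_pt \<theta> = x"
  using support_pt is_support_pt_unique by blast

lemma support_pt_cong: "unit_vec \<theta> = unit_vec \<phi> \<Longrightarrow> support_pt \<theta> = support_pt \<phi>"
  by (rule support_pt_eqI) (use support_pt[of \<phi>] in \<open>simp add: is_support_pt_def\<close>)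

lemma frontier_sub: "frontier K \<subseteq> K"
  using K_facts(5) frontier_subset_closed by blast

lemma supp_fun_support_pt: "supp_fun (frontier K) \<theta> = support_pt \<theta> \<bullet> unit_vec \<theta>"
  unfolding supp_fun_def
  by (rule cSup_eq_maximum)
     (use support_pt[of \<theta>] is_support_pt_frontier[OF support_pt, of \<theta>] frontier_sub in \<open>auto simp: is_support_pt_def simp del: split_paired_All\<close>)

lemma support_pt_continuous: "continuous_on UNIV support_pt"
proof (rule continuous_from_closed_graph[OF K_facts(1)])
  show "support_pt \<in> UNIV \<rightarrow> K" using support_pt by (auto simp: is_support_pt_def)
  have "(\<lambda>x. (x, support_pt x)) ` UNIV =
      UNIV \<times> K \<inter> (\<Inter>y\<in>K. {z. y \<bullet> unit_vec (fst z) \<le> snd z \<bullet> unit_vec (fst z)})"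
    (is "?G = ?R")
  proof (intro equalityI subsetI)
    fix z assume "z \<in> ?G"
    then show "z \<in> ?R" using support_pt unfolding is_support_pt_def by auto
  next
    fix z assume z: "z \<in> ?R"
    have "is_support_pt K (fst z) (snd z)" using z unfolding is_support_pt_def by (auto simp: mem_Times_iff)
    then have "z = (fst z, support_pt (fst z))" by (simp add: support_pt_eqI)
    then show "z \<in> ?G" by blast
  qed
  moreover have "closed \<dots>" unfolding unit_vec_def
    by (intro closed_Int closed_Times closed_INT closed_UNIV K_facts ballI closed_Collect_le continuous_intros)
  ultimately show "closed ((\<lambda>x. (x, support_pt x)) ` UNIV)" by simp
qed

lemma supp_fun_deriv:
  "(supp_fun (frontier K) has_real_derivative (support_pt \<theta> \<bullet> rot90 (unit_vec \<theta>))) (at \<theta>)"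
proof -
  define g where "g t = supp_fun (frontier K) t - support_pt \<theta> \<bullet> unit_vec t" for t
  have le: "\<bar>g t\<bar> \<le> norm (support_pt t - support_pt \<theta>) * norm (unit_vec t - unit_vec \<theta>)" for t
  proof -
    have "support_pt \<theta> \<bullet> unit_vec t \<le> support_pt t \<bullet> unit_vec t" "support_pt t \<bullet> unit_vec \<theta> \<le> support_pt \<theta> \<bullet> unit_vec \<theta>"
      using support_pt by (auto simp: is_support_pt_def)
    then have "0 \<le> g t" "g t \<le> (support_pt t - support_pt \<theta>) \<bullet> (unit_vec t - unit_vec \<theta>)"
      by (auto simp: g_def supp_fun_support_pt inner_diff)
    then show ?thesis
      using norm_cauchy_schwarz[of "support_pt t - support_pt \<theta>" "unit_vec t - unit_vec \<theta>"] by linarith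
  qed
  have lip: "norm (unit_vec t - unit_vec \<theta>) \<le> \<bar>t - \<theta>\<bar>" for t
  proof -
    have "(norm (unit_vec t - unit_vec \<theta>))\<^sup>2 = (cos t - cos \<theta>)\<^sup>2 + (sin t - sin \<theta>)\<^sup>2"
      by (simp add: unit_vec_def norm_Pair)
    also have "\<dots> = 2 - 2 * cos (t - \<theta>)"
      using sin_cos_squared_add[of t] sin_cos_squared_add[of \<theta>]
      by (simp add: cos_diff power2_diff algebra_simps)
    also have "\<dots> = 2 - 2 * cos (2 * ((t - \<theta>) / 2))"
      by (simp only: mult_2 field_sum_of_halves)
    also have "\<dots> = 4 * (sin ((t - \<theta>) / 2))\<^sup>2"
      by (subst cos_double_sin) simp
    also have "\<dots> \<le> 4 * \<bar>(t - \<theta>) / 2\<bar>\<^sup>2"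
      using abs_sin_x_le_abs_x[of "(t - \<theta>) / 2"] by (simp flip: abs_le_square_iff)
    also have "\<dots> = \<bar>t - \<theta>\<bar>\<^sup>2" by (simp add: power_divide)
    finally show ?thesis by (simp flip: abs_le_square_iff)
  qed
  have "(support_pt \<longlongrightarrow> support_pt \<theta>) (at \<theta>)"
    using support_pt_continuous by (simp add: continuous_on_eq_continuous_at isCont_def)
  then have lim0: "((\<lambda>t. norm (support_pt t - support_pt \<theta>)) \<longlongrightarrow> 0) (at \<theta>)"
    by (simp add: LIM_zero tendsto_norm_zero)
  have "((\<lambda>t. (g t - g \<theta>) / (t - \<theta>)) \<longlongrightarrow> 0) (at \<theta>)"
  proof (rule Lim_null_comparison[OF _ lim0])
    have "norm ((g t - g \<theta>) / (t - \<theta>)) \<le> norm (support_pt t - support_pt \<theta>)" if "t \<noteq> \<theta>" for t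
    proof -
      have "\<bar>g t\<bar> \<le> norm (support_pt t - support_pt \<theta>) * \<bar>t - \<theta>\<bar>"
        using le[of t] mult_left_mono[OF lip[of t], of "norm (support_pt t - support_pt \<theta>)"] by simp
      moreover have "g \<theta> = 0" using le[of \<theta>] by simp
      ultimately show ?thesis using that by (simp add: field_simps)
    qed
    then show "\<forall>\<^sub>F t in at \<theta>. norm ((g t - g \<theta>) / (t - \<theta>)) \<le> norm (support_pt t - support_pt \<theta>)"
      by (simp add: eventually_at_filter)
  qed
  then have "(g has_real_derivative 0) (at \<theta>)"
    by (simp add: has_field_derivative_iff)
  moreover have "((\<lambda>t. support_pt \<theta> \<bullet> unit_vec t) has_real_derivative support_pt \<theta> \<bullet> rot90 (unit_vec \<theta>)) (at \<theta>)"
    unfolding unit_vec_def rot90_def inner_prod_def by (auto intro!: derivative_eq_intros)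
  ultimately have "((\<lambda>t. g t + support_pt \<theta> \<bullet> unit_vec t) has_real_derivative
      0 + support_pt \<theta> \<bullet> rot90 (unit_vec \<theta>)) (at \<theta>)"
    by (rule DERIV_add)
  then show ?thesis by (simp add: g_def[abs_def])
qed

lemma supp_param_support_pt: "supp_param (frontier K) \<theta> = support_pt \<theta>"
proof -
  obtain x y where xy: "support_pt \<theta> = (x, y)" by (cases "support_pt \<theta>")
  have "supp_param (frontier K) \<theta> =
     ((x * cos \<theta> + y * sin \<theta>) * cos \<theta> - (y * cos \<theta> - x * sin \<theta>) * sin \<theta>,
      (x * cos \<theta> + y * sin \<theta>) * sin \<theta> + (y * cos \<theta> - x * sin \<theta>) * cos \<theta>)"
    unfolding supp_param_def Let_def supp_fun_support_pt DERIV_imp_deriv[OF supp_fun_deriv[of \<theta>]]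
    by (simp add: xy unit_vec_def rot90_def)
  also have "\<dots> = (x, y)"
    using pyth[of x \<theta>] pyth[of y \<theta>] by (simp add: algebra_simps)
  finally show ?thesis by (simp add: xy)
qed

lemma frontier_support_pt:
  assumes "x \<in> frontier K"
  obtains \<theta> where "0 \<le> \<theta>" "\<theta> < 2 * pi" "x = support_pt \<theta>"
proof -
  have "x \<in> K" "x \<notin> rel_interior K"
    using assms frontier_sub rel_interior_nonempty_interior[OF K_facts(3)] by (auto simp: frontier_def)
  then obtain a where a: "a \<noteq> 0" "\<And>y. y \<in> K \<Longrightarrow> a \<bullet> x \<le> a \<bullet> y"
    using supporting_hyperplane_rel_boundary[OF K_facts(2)] by metis
  obtain \<theta> where t: "0 \<le> \<theta>" "\<theta> < 2 * pi" "- a = norm (- a) *\<^sub>R unit_vec \<theta>"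
    using unit_vec_exhaust[of "- a"] a(1) by auto
  have "y \<bullet> unit_vec \<theta> \<le> x \<bullet> unit_vec \<theta>" if "y \<in> K" for y
  proof -
    have "norm a * (y \<bullet> unit_vec \<theta>) = y \<bullet> (- a)" "norm a * (x \<bullet> unit_vec \<theta>) = x \<bullet> (- a)"
      by (subst t(3), simp)+
    moreover have "y \<bullet> (- a) \<le> x \<bullet> (- a)" using a(2)[OF that] by (simp add: inner_commute)
    ultimately have "norm a * (y \<bullet> unit_vec \<theta>) \<le> norm a * (x \<bullet> unit_vec \<theta>)" by simp
    then show ?thesis using a(1) by simp
  qed
  then have "support_pt \<theta> = x" using \<open>x \<in> K\<close> by (intro support_pt_eqI) (auto simp: is_support_pt_def)
  then show thesis using that t by blast
qed

lemma support_pt_antipodal_neq: "support_pt \<theta> \<noteq> support_pt (\<theta> + pi)"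
proof
  assume eq: "support_pt \<theta> = support_pt (\<theta> + pi)"
  have "y \<bullet> unit_vec \<theta> = support_pt \<theta> \<bullet> unit_vec \<theta>" if "y \<in> K" for y
    using support_pt[of \<theta>] support_pt[of "\<theta> + pi"] that
    by (auto simp: is_support_pt_def unit_vec_minus simp flip: eq intro!: antisym)
  then have "is_support_pt K \<theta> y" if "y \<in> K" for y using that by (auto simp: is_support_pt_def)
  then show False using K_facts(3) interior_not_max[of _ K "unit_vec \<theta>"] interior_subset[of K]
    by (metis equals0I is_support_pt_def not_le subsetD unit_vec_nz)
qed

context
  fixes \<gamma> :: "real \<Rightarrow> plane"
  assumes \<gamma>: "oval \<gamma>" and fr: "frontier K = path_image \<gamma>"
begin

lemma oval_periodic_int: "\<gamma> (t + of_int n) = \<gamma> t"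
proof (induction n rule: int_induct[where k = 0])
  case (step1 i)
  then show ?case using \<gamma> by (metis add.assoc of_int_1 of_int_add oval_def)
next
  case (step2 i)
  have "\<gamma> (t + of_int (i - 1) + 1) = \<gamma> (t + of_int (i - 1))" using \<gamma> unfolding oval_def by blast
  moreover have "t + of_int (i - 1) + 1 = t + of_int i" by simp
  ultimately show ?case using step2 by simp
qed simp

lemma oval_in_frontier: "\<gamma> t \<in> frontier K"
proof -
  have "\<gamma> t = \<gamma> (frac t)"
    using oval_periodic_int[of "frac t" "\<lfloor>t\<rfloor>"] by (simp add: frac_def)
  moreover have "frac t \<in> {0..1}" using frac_lt_1[of t] frac_ge_0[of t] by auto
  ultimately show ?thesis unfolding fr path_image_def by blast
qed

lemma oval_tangent:
  assumes "\<gamma> s = support_pt \<theta>"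
  obtains c where "c > 0" "vderiv \<gamma> s = c *\<^sub>R rot90 (unit_vec \<theta>)"
proof -
  have sm: "(vderiv ^^ n) \<gamma> differentiable (at t)" for n t
    using \<gamma> by (auto simp: oval_def smooth_curve_def)
  have d1: "(\<gamma> has_vector_derivative vderiv \<gamma> t) (at t)" for t
    using sm[of 0 t] by (simp add: vderiv_def vector_derivative_works)
  have d2: "(vderiv \<gamma> has_vector_derivative vderiv (vderiv \<gamma>) t) (at t)" for t
    using sm[of 1 t] unfolding vderiv_def[of "vderiv \<gamma>"] by (simp add: vector_derivative_works)
  define f where "f t = \<gamma> t \<bullet> unit_vec \<theta>" for t
  define f1 where "f1 t = vderiv \<gamma> t \<bullet> unit_vec \<theta>" for t
  define f2 where "f2 = vderiv (vderiv \<gamma>) s \<bullet> unit_vec \<theta>"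
  have f1: "(f has_real_derivative f1 t) (at t)" for t
    unfolding f_def f1_def has_real_derivative_iff_has_vector_derivative
    by (rule bounded_linear.has_vector_derivative[OF bounded_linear_inner_left d1])
  have f2: "(f1 has_real_derivative f2) (at s)"
    unfolding f1_def f2_def has_real_derivative_iff_has_vector_derivative
    by (rule bounded_linear.has_vector_derivative[OF bounded_linear_inner_left d2])
  have fmax: "f t \<le> f s" for t
    using support_pt[of \<theta>] oval_in_frontier[of t] frontier_sub assms by (auto simp: is_support_pt_def f_def)
  have f1s: "f1 s = 0"
    using DERIV_local_max[OF f1[of s], of 1] fmax by simp
  have "f2 \<le> 0"
  proof (rule ccontr)
    assume "\<not> f2 \<le> 0"
    then obtain d where d: "d > 0" "\<And>h. h > 0 \<Longrightarrow> h < d \<Longrightarrow> f1 s < f1 (s + h)"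
      using DERIV_pos_inc_right[OF f2] by auto
    have "f s < f (s + d / 2)"
    proof (rule DERIV_pos_imp_increasing_open[of s "s + d / 2" f])
      show "s < s + d / 2" using d by simp
    next
      fix x assume "s < x" "x < s + d / 2"
      then show "\<exists>y. (f has_real_derivative y) (at x) \<and> y > 0"
        using d f1s f1[of x] by (intro exI[of _ "f1 x"]) (use d(2)[of "x - s"] in auto)
    next
      show "continuous_on {s..s + d / 2} f"
        by (rule DERIV_continuous_on) (blast intro: f1 has_field_derivative_at_within)
    qed
    then show False using fmax[of "s + d/2"] by simp
  qed
  define v where "v = vderiv \<gamma> s"
  define w where "w = vderiv (vderiv \<gamma>) s"
  define c where "c = v \<bullet> rot90 (unit_vec \<theta>)"
  have v: "v = c *\<^sub>R rot90 (unit_vec \<theta>)"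
  proof -
    have o: "fst v * cos \<theta> + snd v * sin \<theta> = 0"
      using f1s by (simp add: f1_def v_def unit_vec_def inner_prod_def)
    have "fst v * (cos \<theta> * cos \<theta>) + fst v * (sin \<theta> * sin \<theta>)
          - cos \<theta> * (fst v * cos \<theta> + snd v * sin \<theta>) =
        - (sin \<theta> * (snd v * cos \<theta> - fst v * sin \<theta>))"
      by (simp add: algebra_simps)
    then have "fst v = - (sin \<theta> * (snd v * cos \<theta> - fst v * sin \<theta>))"
      unfolding o pyth by simp
    moreover have "snd v * (cos \<theta> * cos \<theta>) + snd v * (sin \<theta> * sin \<theta>)
          - sin \<theta> * (fst v * cos \<theta> + snd v * sin \<theta>) =
        cos \<theta> * (snd v * cos \<theta> - fst v * sin \<theta>)"
      by (simp add: algebra_simps)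
    then have "snd v = cos \<theta> * (snd v * cos \<theta> - fst v * sin \<theta>)"
      unfolding o pyth by simp
    moreover have "c = snd v * cos \<theta> - fst v * sin \<theta>"
      by (simp add: c_def rot90_def unit_vec_def inner_prod_def)
    ultimately show ?thesis
      by (simp add: prod_eq_iff rot90_def unit_vec_def mult.commute)
  qed
  have pos: "det2 v w > 0"
    using \<gamma> by (auto simp: oval_def curvature_def v_def w_def zero_less_divide_iff dest!: spec[of _ s])
  have "det2 v w = - c * f2"
    unfolding v f2_def w_def[symmetric]
    by (simp add: det2_def rot90_def unit_vec_def inner_prod_def algebra_simps)
  then have "c > 0"
    using pos \<open>f2 \<le> 0\<close> mult_nonpos_nonpos[of c f2] by (cases "c > 0") auto
  then show thesis using that v by (simp add: v_def)
qed

lemma unit_normal_oval: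
  assumes "\<gamma> s = support_pt \<theta>"
  shows "unit_normal \<gamma> s = - unit_vec \<theta>"
proof -
  obtain c where c: "c > 0" "vderiv \<gamma> s = c *\<^sub>R rot90 (unit_vec \<theta>)"
    using oval_tangent[OF assms] .
  have "norm (rot90 (unit_vec \<theta>)) = 1" by (simp add: rot90_def unit_vec_def norm_Pair)
  then have "norm (vderiv \<gamma> s) = c" using c(1) unfolding c(2) by simp
  then show ?thesis using c(1)
    unfolding unit_normal_def by (simp add: c(2) rot90_def unit_vec_def)
qed

lemma det2_oval:
  assumes "\<gamma> s = support_pt \<theta>" "\<gamma> t = support_pt \<phi>"
  shows "det2 (vderiv \<gamma> s) (vderiv \<gamma> t) = 0 \<longleftrightarrow> sin (\<phi> - \<theta>) = 0"
proof -
  obtain c d where cd: "c > 0" "vderiv \<gamma> s = c *\<^sub>R rot90 (unit_vec \<theta>)"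
     "d > 0" "vderiv \<gamma> t = d *\<^sub>R rot90 (unit_vec \<phi>)"
    using oval_tangent[OF assms(1)] oval_tangent[OF assms(2)] by metis
  have "det2 (vderiv \<gamma> s) (vderiv \<gamma> t) = c * d * sin (\<phi> - \<theta>)"
    unfolding cd(2,4) by (simp add: det2_def rot90_def unit_vec_def sin_diff algebra_simps)
  then show ?thesis using cd(1,3) by simp
qed

lemma CWMS_eq_image: "CWMS \<gamma> = CWMS_param \<gamma> ` {0..2 * pi}"
proof (intro equalityI subsetI)
  fix z assume "z \<in> CWMS \<gamma>"
  then obtain s t where z: "z = \<gamma> s - \<gamma> t + (curve_length \<gamma> / pi) *\<^sub>R unit_normal \<gamma> s"
    and p: "\<gamma> s \<noteq> \<gamma> t" "det2 (vderiv \<gamma> s) (vderiv \<gamma> t) = 0"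
    by (auto simp: CWMS_def parallel_pair_def)
  obtain \<theta> where th: "0 \<le> \<theta>" "\<theta> < 2 * pi" "\<gamma> s = support_pt \<theta>"
    using frontier_support_pt[OF oval_in_frontier] by metis
  obtain \<phi> where ph: "\<gamma> t = support_pt \<phi>"
    using frontier_support_pt[OF oval_in_frontier] by metis
  have "sin (\<phi> - \<theta>) = 0" using det2_oval[OF th(3) ph] p(2) by simp
  moreover have ucos: "unit_vec \<phi> = cos (\<phi> - \<theta>) *\<^sub>R unit_vec \<theta> + sin (\<phi> - \<theta>) *\<^sub>R rot90 (unit_vec \<theta>)"
    using cos_add[of \<theta> "\<phi> - \<theta>"] sin_add[of \<theta> "\<phi> - \<theta>"]
    by (simp add: unit_vec_def rot90_def mult.commute)
  moreover have "cos (\<phi> - \<theta>) = 1 \<or> cos (\<phi> - \<theta>) = - 1"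
    using \<open>sin (\<phi> - \<theta>) = 0\<close> sin_cos_squared_add[of "\<phi> - \<theta>"] by (simp add: power2_eq_1_iff)
  ultimately have "unit_vec \<phi> = unit_vec \<theta> \<or> unit_vec \<phi> = unit_vec (\<theta> + pi)"
    by (auto simp: unit_vec_minus)
  then have "support_pt \<phi> = support_pt (\<theta> + pi)"
    using p(1) th(3) ph support_pt_cong by metis
  then have "z = CWMS_param \<gamma> \<theta>"
    by (simp add: z CWMS_param_def unit_normal_oval[OF th(3)] supp_param_support_pt th(3) ph flip: fr)
  then show "z \<in> CWMS_param \<gamma> ` {0..2 * pi}" using th by auto
next
  fix z assume "z \<in> CWMS_param \<gamma> ` {0..2 * pi}"
  then obtain \<theta> where z: "z = CWMS_param \<gamma> \<theta>" by blast
  obtain s t where s: "\<gamma> s = support_pt \<theta>" and t: "\<gamma> t = support_pt (\<theta> + pi)"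
    using is_support_pt_frontier[OF support_pt] unfolding fr path_image_def by (metis imageE)
  have "parallel_pair \<gamma> s t"
    unfolding parallel_pair_def det2_oval[OF s t] using support_pt_antipodal_neq by (simp add: s t)
  moreover have "z = \<gamma> s - \<gamma> t + (curve_length \<gamma> / pi) *\<^sub>R unit_normal \<gamma> s"
    by (simp add: z CWMS_param_def unit_normal_oval[OF s] supp_param_support_pt s t flip: fr)
  ultimately show "z \<in> CWMS \<gamma>" by (auto simp: CWMS_def)
qed

end

end

end

theory Submission
  imports Defs
begin

text \<open>
  Write the support function of the boundary as a Fourier series.  Its even harmonics, its first
  harmonic and its odd harmonics of order at least three play separate roles.

  The isoperimetric deficit \<open>L\<^sup>2 - 4 * pi * A\<close> is a sum over all harmonics of order at least two, with
  a weight proportional to \<open>n\<^sup>2 - 1\<close> on the energy of order \<open>n\<close>.  The Constant Width Measure Set has twice the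
  mean-free even part as its support function, so its oriented area is negative (or zero), and
  subtracting \<open>pi\<close> times the absolute value removes exactly the even harmonics from the deficit.  The
  left-hand side is therefore \<open>2 * pi\<close> times the integral of \<open>h'\<^sup>2 - h\<^sup>2\<close> for the function \<open>h\<close> that
  collects the odd harmonics of order at least three (\<open>deficit_eq\<close>).  On the other side, the support
  function of the Steiner symmetral consists of the even harmonics and the first one, so \<open>h\<close> is the
  difference of the two support functions and \<open>d2\<^sup>2\<close> is the integral of \<open>h\<^sup>2\<close> (\<open>d2_H0\<close>).  Thus the theorem
  is Wirtinger's inequality \<open>9 * integral h\<^sup>2 \<le> integral h'\<^sup>2\<close> for functions without harmonics of order
  less than three (\<open>wirtinger\<close>), where equality means that \<open>h\<close> is a pure third harmonic.

  Three things have to be supplied.  Wirtinger's inequality with its equality case, as well as the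
  convergent series in the statement, needs Fourier series of continuously differentiable periodic
  functions: pointwise convergence (\<open>fourier_series\<close>) and Parseval's identity (\<open>parseval\<close>).  The
  regularity of the support function comes from the normal angle of the oval, which is a smooth
  parameter that makes exactly one turn (\<open>normal_angle\<close>, \<open>support_pt_C1\<close>).  Finally perimeter and area
  are expressed by the support function: the perimeter by Cauchy's formula (\<open>curve_length_eq\<close>), the
  area by integrating the lengths of vertical slices and substituting the normal angle
  (\<open>area_contour\<close>, \<open>area_eq\<close>).
\<close>

section \<open>Fourier series of continuously differentiable periodic functions\<close>

lemma integral_FTC_real:
  assumes "a \<le> b" "\<And>t. (F has_real_derivative f t) (at t)"
  shows "(f has_integral (F b - F a)) {a..b}"
  using assms
  by (intro fundamental_theorem_of_calculus)
     (auto simp: has_real_derivative_iff_has_vector_derivative intro: has_vector_derivative_at_within)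

lemma has_integral_periodic_derivative:
  assumes "\<And>t. (F has_real_derivative f t) (at t)" and "F (2 * pi) = F 0"
  shows "(f has_integral (0::real)) {0..2 * pi}"
  using integral_FTC_real[OF _ assms(1), of 0 "2 * pi"] assms(2) by simp

lemma continuous_has_antiderivative:
  assumes "continuous_on UNIV (f :: real \<Rightarrow> real)"
  obtains F where "\<And>t. (F has_real_derivative f t) (at t)"
proof -
  have "isCont f t" for t using assms by (simp add: continuous_on_eq_continuous_at)
  then have "\<exists>F. \<forall>t. (F has_vector_derivative f t) (at t)"
    using einterval_antiderivative[of "-\<infinity>" "\<infinity>" f] by simp
  then obtain F where "\<forall>t. (F has_vector_derivative f t) (at t)" by blast
  then show thesis by (intro that[of F]) (simp add: has_real_derivative_iff_has_vector_derivative)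
qed

lemma continuous_on_if_derivative:
  "(\<And>t. (f has_real_derivative f' t) (at t)) \<Longrightarrow> continuous_on A f"
  by (intro continuous_at_imp_continuous_on ballI) (rule DERIV_isCont)

text \<open>
  The increment over a period of an antiderivative of a periodic function does not depend on
  where the period starts, because that increment has derivative zero.
\<close>

lemma integral_periodic_shift:
  fixes f :: "real \<Rightarrow> real"
  assumes cont: "continuous_on UNIV f" and per: "\<And>t. f (t + 2 * pi) = f t"
  shows "integral {0..2 * pi} (\<lambda>t. f (t + a)) = integral {0..2 * pi} f"
proof -
  obtain F where F: "\<And>t. (F has_real_derivative f t) (at t)"
    using continuous_has_antiderivative[OF cont] by blast
  have "((\<lambda>t. F (t + 2 * pi) - F t) has_real_derivative 0) (at t)" for t
    using F[of t] F[of "t + 2 * pi"] per[of t]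
    by (auto intro!: derivative_eq_intros simp: DERIV_shift)
  then have const: "F (a + 2 * pi) - F a = F (0 + 2 * pi) - F 0"
    using DERIV_isconst_all[of "\<lambda>t. F (t + 2 * pi) - F t" a 0] by blast
  have "((\<lambda>t. F (t + a)) has_real_derivative f (t + a)) (at t)" for t
    using F[of "t + a"] unfolding DERIV_shift .
  then have "((\<lambda>t. f (t + a)) has_integral (F (2 * pi + a) - F (0 + a))) {0..2 * pi}"
    by (intro integral_FTC_real) auto
  moreover have "(f has_integral (F (2 * pi) - F 0)) {0..2 * pi}"
    by (intro integral_FTC_real F) auto
  ultimately show ?thesis using const by (simp add: integral_unique add.commute)
qed

subsection \<open>Fourier coefficients and orthogonality\<close>

definition fourier_cos :: "(real \<Rightarrow> real) \<Rightarrow> nat \<Rightarrow> real" where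
  "fourier_cos f n = integral {0..2 * pi} (\<lambda>t. f t * cos (real n * t)) / pi"

definition fourier_sin :: "(real \<Rightarrow> real) \<Rightarrow> nat \<Rightarrow> real" where
  "fourier_sin f n = integral {0..2 * pi} (\<lambda>t. f t * sin (real n * t)) / pi"

text \<open>
  With the normalization by \<open>pi\<close>, the harmonic of order zero is twice the mean of \<open>f\<close>.  This is why order
  zero is excluded below and why half of \<open>fourier_cos f 0\<close> appears in the series.
\<close>

definition harmonic :: "(real \<Rightarrow> real) \<Rightarrow> nat \<Rightarrow> real \<Rightarrow> real" where
  "harmonic f n t = fourier_cos f n * cos (real n * t) + fourier_sin f n * sin (real n * t)"

definition energy :: "(real \<Rightarrow> real) \<Rightarrow> nat \<Rightarrow> real" where
  "energy f n = (fourier_cos f n)\<^sup>2 + (fourier_sin f n)\<^sup>2"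

lemma energy_nonneg: "energy f n \<ge> 0"
  by (simp add: energy_def)

lemma continuous_on_harmonic [continuous_intros]: "continuous_on A (harmonic f n)"
  unfolding harmonic_def[abs_def] by (intro continuous_intros)

lemma integral_cos_int: "integral {0..2 * pi} (\<lambda>t. cos (of_int k * t)) = (if k = 0 then 2 * pi else 0)"
proof (cases "k = 0")
  case False
  have "((\<lambda>t. cos (of_int k * t)) has_integral 0) {0..2 * pi}"
    by (rule has_integral_periodic_derivative[of "\<lambda>t. sin (of_int k * t) / of_int k"])
       (use False sin_int_2pin[of k] in \<open>auto intro!: derivative_eq_intros simp: mult.commute mult.left_commute\<close>)
  then show ?thesis using False by (simp add: integral_unique)
qed simp

lemma integral_sin_int: "integral {0..2 * pi} (\<lambda>t. sin (of_int k * t)) = 0"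
proof (cases "k = 0")
  case False
  have "((\<lambda>t. sin (of_int k * t)) has_integral 0) {0..2 * pi}"
    by (rule has_integral_periodic_derivative[of "\<lambda>t. - cos (of_int k * t) / of_int k"])
       (use False cos_int_2pin[of k] in \<open>auto intro!: derivative_eq_intros simp: mult.commute mult.left_commute\<close>)
  then show ?thesis by (simp add: integral_unique)
qed simp

lemma trig_orthogonality:
  assumes "m \<noteq> 0"
  shows "integral {0..2 * pi} (\<lambda>t. cos (real m * t) * cos (real n * t)) = (if m = n then pi else 0)"
    and "integral {0..2 * pi} (\<lambda>t. sin (real m * t) * sin (real n * t)) = (if m = n then pi else 0)"
    and "integral {0..2 * pi} (\<lambda>t. sin (real m * t) * cos (real n * t)) = 0"
proof -
  let ?d = "int m - int n" and ?s = "int m + int n"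
  note [simp] = integral_cos_int integral_sin_int
  have c: "(\<lambda>t. cos (of_int k * t) / 2) integrable_on {0..2 * pi}"
       "(\<lambda>t. sin (of_int k * t) / 2) integrable_on {0..2 * pi}" for k
    by (intro integrable_continuous_real continuous_intros; simp)+
  have "integral {0..2 * pi} (\<lambda>t. cos (real m * t) * cos (real n * t)) =
      integral {0..2 * pi} (\<lambda>t. cos (of_int ?d * t) / 2 + cos (of_int ?s * t) / 2)"
    by (simp add: cos_times_cos algebra_simps add_divide_distrib)
  also have "\<dots> = (if m = n then pi else 0)"
    using assms by (subst integral_add[OF c(1) c(1)]) (simp del: of_int_diff of_int_add)
  finally show "integral {0..2 * pi} (\<lambda>t. cos (real m * t) * cos (real n * t)) = (if m = n then pi else 0)" .
  have "integral {0..2 * pi} (\<lambda>t. sin (real m * t) * sin (real n * t)) =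
      integral {0..2 * pi} (\<lambda>t. cos (of_int ?d * t) / 2 - cos (of_int ?s * t) / 2)"
    by (simp add: sin_times_sin algebra_simps diff_divide_distrib)
  also have "\<dots> = (if m = n then pi else 0)"
    using assms by (subst integral_diff[OF c(1) c(1)]) (simp del: of_int_diff of_int_add)
  finally show "integral {0..2 * pi} (\<lambda>t. sin (real m * t) * sin (real n * t)) = (if m = n then pi else 0)" .
  have "integral {0..2 * pi} (\<lambda>t. sin (real m * t) * cos (real n * t)) =
      integral {0..2 * pi} (\<lambda>t. sin (of_int ?s * t) / 2 + sin (of_int ?d * t) / 2)"
    by (simp add: sin_times_cos left_diff_distrib distrib_right add_divide_distrib)
  also have "\<dots> = 0"
    by (subst integral_add[OF c(2) c(2)]) (simp del: of_int_diff of_int_add)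
  finally show "integral {0..2 * pi} (\<lambda>t. sin (real m * t) * cos (real n * t)) = 0" .
qed

lemma has_integral_trig_products:
  assumes "m \<noteq> 0"
  shows "((\<lambda>t. cos (real m * t) * cos (real n * t)) has_integral (if m = n then pi else 0)) {0..2 * pi}"
    and "((\<lambda>t. sin (real m * t) * sin (real n * t)) has_integral (if m = n then pi else 0)) {0..2 * pi}"
    and "((\<lambda>t. sin (real m * t) * cos (real n * t)) has_integral 0) {0..2 * pi}"
    and "((\<lambda>t. cos (real n * t) * sin (real m * t)) has_integral 0) {0..2 * pi}"
proof -
  have i: "(\<lambda>t. f (real m * t) * g (real n * t)) integrable_on {0..2 * pi}"
    if "continuous_on UNIV f" "continuous_on UNIV g" for f g :: "real \<Rightarrow> real"
    by (intro integrable_continuous_real continuous_intros continuous_on_compose2[OF that(1)]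
        continuous_on_compose2[OF that(2)]) auto
  have c: "continuous_on UNIV (cos :: real \<Rightarrow> real)" "continuous_on UNIV (sin :: real \<Rightarrow> real)"
    by (intro continuous_intros)+
  show "((\<lambda>t. cos (real m * t) * cos (real n * t)) has_integral (if m = n then pi else 0)) {0..2 * pi}"
    and "((\<lambda>t. sin (real m * t) * sin (real n * t)) has_integral (if m = n then pi else 0)) {0..2 * pi}"
    and sc: "((\<lambda>t. sin (real m * t) * cos (real n * t)) has_integral 0) {0..2 * pi}"
    using i c trig_orthogonality[OF assms] by (auto simp: has_integral_iff)
  show "((\<lambda>t. cos (real n * t) * sin (real m * t)) has_integral 0) {0..2 * pi}"
    using sc by (simp only: mult.commute)
qed

lemma integral_times_harmonic:
  assumes [continuous_intros]: "continuous_on {0..2 * pi} g"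
  shows "integral {0..2 * pi} (\<lambda>t. g t * harmonic f n t)
     = pi * (fourier_cos f n * fourier_cos g n + fourier_sin f n * fourier_sin g n)"
proof -
  have "integral {0..2 * pi} (\<lambda>t. g t * harmonic f n t) =
      integral {0..2 * pi} (\<lambda>t. fourier_cos f n * (g t * cos (real n * t)) + fourier_sin f n * (g t * sin (real n * t)))"
    by (simp add: harmonic_def algebra_simps)
  also have "\<dots> = integral {0..2 * pi} (\<lambda>t. fourier_cos f n * (g t * cos (real n * t)))
      + integral {0..2 * pi} (\<lambda>t. fourier_sin f n * (g t * sin (real n * t)))"
    by (intro integral_add integrable_continuous_real continuous_intros assms)
  also have "\<dots> = fourier_cos f n * (pi * fourier_cos g n) + fourier_sin f n * (pi * fourier_sin g n)"
    by (simp add: fourier_cos_def[of g] fourier_sin_def[of g])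
  also have "\<dots> = pi * (fourier_cos f n * fourier_cos g n + fourier_sin f n * fourier_sin g n)"
    by (simp add: algebra_simps)
  finally show ?thesis .
qed

lemma coeff_harmonic:
  assumes "m \<noteq> 0"
  shows "fourier_cos (harmonic f m) n = (if m = n then fourier_cos f m else 0)"
    and "fourier_sin (harmonic f m) n = (if m = n then fourier_sin f m else 0)"
proof -
  have "integral {0..2 * pi} (\<lambda>t. harmonic f m t * cos (real n * t)) =
      integral {0..2 * pi} (\<lambda>t. cos (real n * t) * harmonic f m t)"
    by (simp add: mult.commute)
  also have "\<dots> = pi * (if m = n then fourier_cos f m else 0)"
    unfolding integral_times_harmonic[of "\<lambda>t. cos (real n * t)", OF continuous_on_cos[OF continuous_on_mult_left[OF continuous_on_id]]]
    unfolding fourier_cos_def[of "\<lambda>t. cos (real n * t)"] fourier_sin_def[of "\<lambda>t. cos (real n * t)"]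
    using trig_orthogonality(1,3)[OF assms, of n] by (simp add: mult.commute)
  finally show "fourier_cos (harmonic f m) n = (if m = n then fourier_cos f m else 0)"
    by (simp add: fourier_cos_def[of "harmonic f m"])
  have "integral {0..2 * pi} (\<lambda>t. sin (real n * t) * cos (real m * t)) = 0"
    using trig_orthogonality(3)[of n m] by (cases "n = 0") simp_all
  then have "integral {0..2 * pi} (\<lambda>t. sin (real n * t) * harmonic f m t) = pi * (if m = n then fourier_sin f m else 0)"
    unfolding integral_times_harmonic[of "\<lambda>t. sin (real n * t)", OF continuous_on_sin[OF continuous_on_mult_left[OF continuous_on_id]]]
    unfolding fourier_cos_def[of "\<lambda>t. sin (real n * t)"] fourier_sin_def[of "\<lambda>t. sin (real n * t)"]
    using trig_orthogonality(2)[OF assms, of n] by (simp add: mult.commute)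
  then show "fourier_sin (harmonic f m) n = (if m = n then fourier_sin f m else 0)"
    by (simp add: fourier_sin_def[of "harmonic f m"] mult.commute)
qed

lemma coeff_sum:
  assumes "\<And>i. i \<in> A \<Longrightarrow> continuous_on {0..2 * pi} (f i)"
  shows "fourier_cos (\<lambda>t. \<Sum>i\<in>A. f i t) n = (\<Sum>i\<in>A. fourier_cos (f i) n)"
    and "fourier_sin (\<lambda>t. \<Sum>i\<in>A. f i t) n = (\<Sum>i\<in>A. fourier_sin (f i) n)"
proof -
  show "fourier_cos (\<lambda>t. \<Sum>i\<in>A. f i t) n = (\<Sum>i\<in>A. fourier_cos (f i) n)"
  proof (cases "finite A")
    case True
    have "integral {0..2 * pi} (\<lambda>t. \<Sum>i\<in>A. f i t * cos (real n * t)) =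
        (\<Sum>i\<in>A. integral {0..2 * pi} (\<lambda>t. f i t * cos (real n * t)))"
      by (intro integral_sum True integrable_continuous_real continuous_intros assms)
    then show ?thesis by (simp add: fourier_cos_def sum_distrib_right sum_divide_distrib)
  qed (simp add: fourier_cos_def)
  show "fourier_sin (\<lambda>t. \<Sum>i\<in>A. f i t) n = (\<Sum>i\<in>A. fourier_sin (f i) n)"
  proof (cases "finite A")
    case True
    have "integral {0..2 * pi} (\<lambda>t. \<Sum>i\<in>A. f i t * sin (real n * t)) =
        (\<Sum>i\<in>A. integral {0..2 * pi} (\<lambda>t. f i t * sin (real n * t)))"
      by (intro integral_sum True integrable_continuous_real continuous_intros assms)
    then show ?thesis by (simp add: fourier_sin_def sum_distrib_right sum_divide_distrib)
  qed (simp add: fourier_sin_def)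
qed

lemma integral_times_trig_sum:
  assumes "continuous_on {0..2 * pi} g" "finite A"
  shows "integral {0..2 * pi} (\<lambda>t. g t * (\<Sum>n\<in>A. harmonic f n t))
     = pi * (\<Sum>n\<in>A. fourier_cos f n * fourier_cos g n + fourier_sin f n * fourier_sin g n)"
proof -
  have "integral {0..2 * pi} (\<lambda>t. g t * (\<Sum>n\<in>A. harmonic f n t))
     = (\<Sum>n\<in>A. integral {0..2 * pi} (\<lambda>t. g t * harmonic f n t))"
    unfolding sum_distrib_left
    by (intro integral_sum assms integrable_continuous_real continuous_intros)
  then show ?thesis by (simp add: integral_times_harmonic assms(1) sum_distrib_left)
qed

text \<open>
  The squared distance from \<open>f\<close> to the trigonometric polynomial built from its own coefficients
  is nonnegative; by orthogonality it is the difference of the two sides.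
\<close>

lemma bessel:
  assumes f: "continuous_on {0..2 * pi} f" and A: "finite A" "0 \<notin> A"
  shows "pi * (\<Sum>n\<in>A. energy f n) \<le> integral {0..2 * pi} (\<lambda>t. (f t)\<^sup>2)"
proof -
  define T where "T = (\<lambda>t. \<Sum>n\<in>A. harmonic f n t)"
  have T: "continuous_on {0..2 * pi} T" unfolding T_def by (intro continuous_intros)
  have TT: "fourier_cos T n = fourier_cos f n" "fourier_sin T n = fourier_sin f n" if "n \<in> A" for n
  proof -
    have "fourier_cos T n = (\<Sum>m\<in>A. if m = n then fourier_cos f m else 0)"
         "fourier_sin T n = (\<Sum>m\<in>A. if m = n then fourier_sin f m else 0)"
      unfolding T_def
      by (subst coeff_sum, intro continuous_intros,
          intro sum.cong refl coeff_harmonic, metis A(2))+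
    then show "fourier_cos T n = fourier_cos f n" "fourier_sin T n = fourier_sin f n" using that A(1) by simp_all
  qed
  have fT: "integral {0..2 * pi} (\<lambda>t. f t * T t) = pi * (\<Sum>n\<in>A. energy f n)"
    unfolding T_def integral_times_trig_sum[OF f A(1)] by (simp add: energy_def power2_eq_square)
  have "integral {0..2 * pi} (\<lambda>t. T t * T t) = pi * (\<Sum>n\<in>A. fourier_cos f n * fourier_cos T n + fourier_sin f n * fourier_sin T n)"
    using integral_times_trig_sum[OF T A(1), of f] unfolding T_def .
  then have "integral {0..2 * pi} (\<lambda>t. T t * T t) = pi * (\<Sum>n\<in>A. energy f n)"
    by (simp add: energy_def power2_eq_square TT)
  moreover have "0 \<le> integral {0..2 * pi} (\<lambda>t. (f t - T t)\<^sup>2)"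
    by (intro integral_nonneg integrable_continuous_real continuous_intros f T) simp
  moreover have "integral {0..2 * pi} (\<lambda>t. (f t - T t)\<^sup>2) =
      integral {0..2 * pi} (\<lambda>t. (f t)\<^sup>2 - 2 * (f t * T t) + T t * T t)"
    by (simp add: power2_eq_square algebra_simps)
  moreover have "\<dots> = integral {0..2 * pi} (\<lambda>t. (f t)\<^sup>2 - 2 * (f t * T t)) + integral {0..2 * pi} (\<lambda>t. T t * T t)"
    by (intro integral_add integrable_continuous_real continuous_intros f T)
  moreover have "integral {0..2 * pi} (\<lambda>t. (f t)\<^sup>2 - 2 * (f t * T t)) =
      integral {0..2 * pi} (\<lambda>t. (f t)\<^sup>2) - integral {0..2 * pi} (\<lambda>t. 2 * (f t * T t))"
    by (intro integral_diff integrable_continuous_real continuous_intros f T)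
  ultimately show ?thesis using fT by simp
qed

lemma energy_partial_sum_le:
  assumes "continuous_on {0..2 * pi} f"
  shows "(\<Sum>n<N. energy f (Suc n)) \<le> integral {0..2 * pi} (\<lambda>t. (f t)\<^sup>2) / pi"
proof -
  have "(\<Sum>n<N. energy f (Suc n)) = (\<Sum>n\<in>{Suc 0..<Suc N}. energy f n)"
    by (simp add: sum.atLeast_Suc_lessThan_Suc_shift atLeast0LessThan del: sum.op_ivl_Suc)
  then show ?thesis
    using bessel[OF assms, of "{Suc 0..<Suc N}"] by (simp add: field_simps del: sum.op_ivl_Suc)
qed

lemma summable_energy:
  assumes "continuous_on {0..2 * pi} f"
  shows "summable (\<lambda>n. energy f (Suc n))"
  by (rule summableI_nonneg_bounded[OF energy_nonneg energy_partial_sum_le[OF assms]])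

text \<open>
  By Bessel's inequality the energies are summable, so they tend to zero.
\<close>

lemma riemann_lebesgue:
  assumes "continuous_on {0..2 * pi} f"
  shows "fourier_cos f \<longlonglongrightarrow> 0" and "fourier_sin f \<longlonglongrightarrow> 0"
proof -
  have "energy f \<longlonglongrightarrow> 0"
    using summable_LIMSEQ_zero[OF summable_energy[OF assms]] by (rule LIMSEQ_imp_Suc)
  then have lim: "(\<lambda>n. sqrt (energy f n)) \<longlonglongrightarrow> 0"
    using tendsto_real_sqrt by fastforce
  show "fourier_cos f \<longlonglongrightarrow> 0"
    by (rule Lim_null_comparison[OF _ lim]) (auto simp: energy_def intro!: always_eventually)
  show "fourier_sin f \<longlonglongrightarrow> 0"
    by (rule Lim_null_comparison[OF _ lim]) (auto simp: energy_def intro!: always_eventually)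
qed

subsection \<open>Pointwise convergence and Parseval's identity\<close>

text \<open>
  The Dirichlet kernel; multiplied by \<open>2 * sin (t / 2)\<close> its sum telescopes.
\<close>

lemma dirichlet_kernel:
  "2 * sin (t / 2) * (1 / 2 + (\<Sum>n<N. cos (real (Suc n) * t))) = sin (real N * t + t / 2)"
proof (induction N)
  case (Suc N)
  have "2 * sin (t / 2) * cos (real (Suc N) * t) = sin (real (Suc N) * t + t / 2) - sin (real (Suc N) * t - t / 2)"
    by (simp add: sin_add sin_diff)
  moreover have "real (Suc N) * t - t / 2 = real N * t + t / 2" by (simp add: field_simps)
  ultimately show ?case using Suc.IH by (simp add: distrib_left del: of_nat_Suc)
qed simp

locale periodic_C1 =
  fixes h h' :: "real \<Rightarrow> real"
  assumes deriv: "\<And>t. (h has_real_derivative h' t) (at t)"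
    and cont': "continuous_on UNIV h'"
    and periodic: "\<And>t. h (t + 2 * pi) = h t"
begin

lemma cont: "continuous_on A h"
  using deriv by (rule continuous_on_if_derivative)

lemma cont'_on: "continuous_on A h'"
  using cont' continuous_on_subset by blast

lemma periodic': "h' (t + 2 * pi) = h' t"
proof -
  have "((\<lambda>t. h (t + 2 * pi)) has_real_derivative h' (t + 2 * pi)) (at t)"
    using deriv[of "t + 2 * pi"] unfolding DERIV_shift .
  then show ?thesis using deriv[of t] DERIV_unique by (simp add: periodic)
qed

lemma coeff_deriv:
  "fourier_cos h' n = real n * fourier_sin h n" "fourier_sin h' n = - (real n * fourier_cos h n)"
proof -
  have h0: "h (2 * pi) = h 0" using periodic[of 0] by simp
  have "((\<lambda>t. h' t * cos (real n * t) - real n * (h t * sin (real n * t))) has_integral 0) {0..2 * pi}"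
    using h0 sin_int_2pin[of "int n"] cos_int_2pin[of "int n"]
    by (intro has_integral_periodic_derivative[of "\<lambda>t. h t * cos (real n * t)"])
       (auto intro!: derivative_eq_intros deriv simp: mult.commute mult.left_commute)
  moreover have "integral {0..2 * pi} (\<lambda>t. h' t * cos (real n * t) - real n * (h t * sin (real n * t)))
      = integral {0..2 * pi} (\<lambda>t. h' t * cos (real n * t)) - integral {0..2 * pi} (\<lambda>t. real n * (h t * sin (real n * t)))"
    by (intro integral_diff integrable_continuous_real continuous_intros cont cont'_on)
  ultimately show "fourier_cos h' n = real n * fourier_sin h n"
    by (simp add: fourier_cos_def fourier_sin_def integral_unique)
  have "((\<lambda>t. h' t * sin (real n * t) + real n * (h t * cos (real n * t))) has_integral 0) {0..2 * pi}"
    using h0 sin_int_2pin[of "int n"] cos_int_2pin[of "int n"]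
    by (intro has_integral_periodic_derivative[of "\<lambda>t. h t * sin (real n * t)"])
       (auto intro!: derivative_eq_intros deriv simp: mult.commute mult.left_commute)
  moreover have "integral {0..2 * pi} (\<lambda>t. h' t * sin (real n * t) + real n * (h t * cos (real n * t)))
      = integral {0..2 * pi} (\<lambda>t. h' t * sin (real n * t)) + integral {0..2 * pi} (\<lambda>t. real n * (h t * cos (real n * t)))"
    by (intro integral_add integrable_continuous_real continuous_intros cont cont'_on)
  ultimately show "fourier_sin h' n = - (real n * fourier_cos h n)"
    by (simp add: fourier_cos_def fourier_sin_def integral_unique field_simps)
qed

lemma energy_deriv: "energy h' n = (real n)\<^sup>2 * energy h n"
  by (simp add: energy_def coeff_deriv power_mult_distrib algebra_simps)

text \<open>
  Convergence at a zero of \<open>h\<close>.  Since \<open>h\<close> is differentiable, it can be divided by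
  \<open>2 * sin (t / 2)\<close>: the quotient \<open>\<psi>\<close> extends continuously to both ends of the period.  That factor is
  exactly the denominator of the Dirichlet kernel, so the partial sum of order \<open>N\<close> is a Fourier
  coefficient of order \<open>N\<close> of continuous functions and vanishes in the limit by Riemann--Lebesgue.
\<close>

lemma fourier_at_zero:
  assumes "h 0 = 0"
  shows "(\<lambda>n. fourier_cos h (Suc n)) sums (- fourier_cos h 0 / 2)"
proof -
  \<comment> \<open>The values at the ends are the quotients of the derivatives; that of \<open>2 * sin (t / 2)\<close> is
      \<open>cos (t / 2)\<close>, which is \<open>1\<close> at \<open>0\<close> and \<open>-1\<close> at \<open>2 * pi\<close>.\<close>
  define \<psi> where "\<psi> t = (if t = 0 then h' 0 else if t = 2 * pi then - h' 0 else h t / (2 * sin (t / 2)))" for t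
  have h0: "h (2 * pi) = 0" using periodic[of 0] assms by simp
  have nz: "sin (t / 2) \<noteq> 0" if "t \<in> {0<..<2 * pi}" for t
    using sin_gt_zero[of "t / 2"] that by auto
  have eq: "h t = 2 * sin (t / 2) * \<psi> t" if "t \<in> {0..2 * pi}" for t
    using that nz[of t] h0 assms by (auto simp: \<psi>_def)
  have quot: "((\<lambda>t. h t / (2 * sin (t / 2))) \<longlongrightarrow> h' a / cos (a / 2)) (at a)"
    if "h a = 0" "sin (a / 2) = 0" for a
  proof -
    have c: "cos (a / 2) \<noteq> 0" using that(2) sin_cos_squared_add[of "a / 2"] by auto
    have "((\<lambda>t. 2 * sin (t / 2)) has_real_derivative cos (a / 2)) (at a)"
      by (auto intro!: derivative_eq_intros)
    then have "((\<lambda>t. (2 * sin (t / 2) - 2 * sin (a / 2)) / (t - a)) \<longlongrightarrow> cos (a / 2)) (at a)"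
      by (simp add: has_field_derivative_iff)
    moreover have "((\<lambda>t. (h t - h a) / (t - a)) \<longlongrightarrow> h' a) (at a)"
      using deriv[of a] by (simp add: has_field_derivative_iff)
    ultimately have "((\<lambda>t. ((h t - h a) / (t - a)) / ((2 * sin (t / 2) - 2 * sin (a / 2)) / (t - a)))
        \<longlongrightarrow> h' a / cos (a / 2)) (at a)"
      using c by (intro tendsto_divide)
    moreover have "\<forall>\<^sub>F t in at a. ((h t - h a) / (t - a)) / ((2 * sin (t / 2) - 2 * sin (a / 2)) / (t - a)) = h t / (2 * sin (t / 2))"
      using that by (auto simp: eventually_at_filter)
    ultimately show ?thesis by (rule Lim_transform_eventually)
  qed
  have "continuous (at t within {0..2 * pi}) \<psi>" if t: "t \<in> {0..2 * pi}" for t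
  proof -
    have "\<forall>\<^sub>F s in at t. h s / (2 * sin (s / 2)) = \<psi> s"
      using eventually_neq_at_within[of 0 t UNIV] eventually_neq_at_within[of "2 * pi" t UNIV]
      by eventually_elim (simp add: \<psi>_def)
    moreover have "((\<lambda>s. h s / (2 * sin (s / 2))) \<longlongrightarrow> \<psi> t) (at t)"
    proof -
      consider "t = 0" | "t = 2 * pi" | "t \<in> {0<..<2 * pi}" using t by force
      then show ?thesis
      proof cases
        case 1 then show ?thesis using quot[of 0] assms by (simp add: \<psi>_def)
      next
        case 2 then show ?thesis using quot[of "2 * pi"] h0 periodic'[of 0] by (simp add: \<psi>_def)
      next
        case 3
        have "isCont h t" using deriv by (rule DERIV_isCont)
        then have "isCont (\<lambda>s. h s / (2 * sin (s / 2))) t"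
          using nz[OF 3] by (intro continuous_intros) auto
        then show ?thesis using 3 by (simp add: isCont_def \<psi>_def)
      qed
    qed
    ultimately have "(\<psi> \<longlongrightarrow> \<psi> t) (at t)" by (rule Lim_transform_eventually[rotated])
    then have "isCont \<psi> t" by (simp add: isCont_def)
    then show ?thesis by (rule continuous_at_imp_continuous_at_within)
  qed
  then have \<psi>: "continuous_on {0..2 * pi} \<psi>" by (simp add: continuous_on_eq_continuous_within)
  define \<alpha> where "\<alpha> t = \<psi> t * cos (t / 2)" for t
  define \<beta> where "\<beta> t = \<psi> t * sin (t / 2)" for t
  have \<alpha>: "continuous_on {0..2 * pi} \<alpha>" and \<beta>: "continuous_on {0..2 * pi} \<beta>"
    unfolding \<alpha>_def \<beta>_def by (intro continuous_intros \<psi>; simp)+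
  have "fourier_cos h 0 / 2 + (\<Sum>n<N. fourier_cos h (Suc n)) = fourier_sin \<alpha> N + fourier_cos \<beta> N" for N
  proof -
    have "pi * (fourier_cos h 0 / 2 + (\<Sum>n<N. fourier_cos h (Suc n))) =
       integral {0..2 * pi} (\<lambda>t. h t * (1/2)) + (\<Sum>n<N. integral {0..2 * pi} (\<lambda>t. h t * cos (real (Suc n) * t)))"
      by (simp add: fourier_cos_def distrib_left sum_distrib_left del: of_nat_Suc)
    also have "(\<Sum>n<N. integral {0..2 * pi} (\<lambda>t. h t * cos (real (Suc n) * t))) = 
       integral {0..2 * pi} (\<lambda>t. \<Sum>n<N. h t * cos (real (Suc n) * t))"
      by (intro integral_sum[symmetric] integrable_continuous_real continuous_intros cont) simp
    also have "integral {0..2 * pi} (\<lambda>t. h t * (1/2)) + \<dots> =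
       integral {0..2 * pi} (\<lambda>t. h t * (1/2) + (\<Sum>n<N. h t * cos (real (Suc n) * t)))"
      by (intro integral_add[symmetric] integrable_continuous_real continuous_intros cont) simp
    also have "\<dots> = integral {0..2 * pi} (\<lambda>t. \<alpha> t * sin (real N * t) + \<beta> t * cos (real N * t))"
    proof (rule integral_cong)
      fix t assume "t \<in> {0..2 * pi}"
      then have "h t * (1/2) + (\<Sum>n<N. h t * cos (real (Suc n) * t)) =
          \<psi> t * (2 * sin (t / 2) * (1 / 2 + (\<Sum>n<N. cos (real (Suc n) * t))))"
        by (simp add: eq distrib_left sum_distrib_left mult_ac del: of_nat_Suc)
      then show "h t * (1/2) + (\<Sum>n<N. h t * cos (real (Suc n) * t)) = \<alpha> t * sin (real N * t) + \<beta> t * cos (real N * t)"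
        unfolding dirichlet_kernel by (simp add: \<alpha>_def \<beta>_def sin_add algebra_simps)
    qed
    also have "\<dots> = pi * (fourier_sin \<alpha> N + fourier_cos \<beta> N)"
      by (subst integral_add) (auto intro!: integrable_continuous_real continuous_intros \<alpha> \<beta> simp: fourier_sin_def fourier_cos_def distrib_left)
    finally show ?thesis by simp
  qed
  then have *: "(\<Sum>n<N. fourier_cos h (Suc n)) = fourier_sin \<alpha> N + fourier_cos \<beta> N - fourier_cos h 0 / 2" for N
    by (simp add: algebra_simps)
  have "(\<lambda>N. fourier_sin \<alpha> N + fourier_cos \<beta> N - fourier_cos h 0 / 2) \<longlonglongrightarrow> 0 + 0 - fourier_cos h 0 / 2"
    by (intro tendsto_intros riemann_lebesgue \<alpha> \<beta>)
  then show ?thesis unfolding sums_def * by simp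
qed


text \<open>
  The general point is reduced to the previous lemma by a translation of the argument and the
  subtraction of a constant.
\<close>

lemma fourier_series: "(\<lambda>n. harmonic h (Suc n) x) sums (h x - fourier_cos h 0 / 2)"
proof -
  interpret \<phi>: periodic_C1 "\<lambda>t. h (t + x) - h x" "\<lambda>t. h' (t + x)"
  proof
    show "((\<lambda>t. h (t + x) - h x) has_real_derivative h' (t + x)) (at t)" for t
      using deriv[of "t + x"] unfolding DERIV_shift by (auto intro!: derivative_eq_intros)
    show "continuous_on UNIV (\<lambda>t. h' (t + x))"
      by (intro continuous_on_compose2[OF cont'] continuous_intros) auto
    show "h (t + 2 * pi + x) - h x = h (t + x) - h x" for t
      using periodic[of "t + x"] by (simp add: add_ac)
  qed
  have shift: "integral {0..2 * pi} (\<lambda>t. h (t + x) * cos (real n * t)) = pi * harmonic h n x" for n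
  proof -
    have "integral {0..2 * pi} (\<lambda>t. h (t + x) * cos (real n * t)) =
        integral {0..2 * pi} (\<lambda>t. h (t + x) * cos (real n * (t + x - x)))" by simp
    also have "\<dots> = integral {0..2 * pi} (\<lambda>t. h t * cos (real n * (t - x)))"
    proof (rule integral_periodic_shift[of "\<lambda>t. h t * cos (real n * (t - x))"])
      show "continuous_on UNIV (\<lambda>t. h t * cos (real n * (t - x)))"
        by (intro continuous_intros cont)
      have "cos (real n * (t + 2 * pi - x)) = cos (real n * (t - x) + of_int (int n) * (2 * pi))" for t
        by (simp add: algebra_simps)
      also have "\<dots> t = cos (real n * (t - x))" for t
        using cos_int_2pin[of "int n"] sin_int_2pin[of "int n"] by (simp add: cos_add mult_ac)
      finally show "h (t + 2 * pi) * cos (real n * (t + 2 * pi - x)) = h t * cos (real n * (t - x))" for t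
        by (simp add: periodic)
    qed
    also have "\<dots> = integral {0..2 * pi} (\<lambda>t. cos (real n * x) * (h t * cos (real n * t)) + sin (real n * x) * (h t * sin (real n * t)))"
      by (simp add: right_diff_distrib cos_diff algebra_simps)
    also have "\<dots> = integral {0..2 * pi} (\<lambda>t. cos (real n * x) * (h t * cos (real n * t)))
        + integral {0..2 * pi} (\<lambda>t. sin (real n * x) * (h t * sin (real n * t)))"
      by (intro integral_add integrable_continuous_real continuous_intros cont)
    also have "\<dots> = pi * harmonic h n x"
      unfolding harmonic_def fourier_cos_def fourier_sin_def integral_mult_right by (simp add: distrib_left)
    finally show ?thesis .
  qed
  have coeff: "fourier_cos (\<lambda>t. h (t + x) - h x) n = harmonic h n x - (if n = 0 then 2 * h x else 0)" for n
  proof -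
    have "integral {0..2 * pi} (\<lambda>t. (h (t + x) - h x) * cos (real n * t)) =
       integral {0..2 * pi} (\<lambda>t. h (t + x) * cos (real n * t) - h x * cos (of_int (int n) * t))"
      by (simp add: algebra_simps)
    also have "\<dots> = pi * harmonic h n x - h x * integral {0..2 * pi} (\<lambda>t. cos (of_int (int n) * t))"
      by (subst integral_diff)
         (auto intro!: integrable_continuous_real continuous_intros continuous_on_compose2[OF cont[of UNIV]] simp: shift)
    finally show ?thesis
      unfolding fourier_cos_def[of "\<lambda>t. h (t + x) - h x"] integral_cos_int by (simp add: diff_divide_distrib)
  qed
  show ?thesis
    using \<phi>.fourier_at_zero unfolding coeff by (simp add: harmonic_def diff_divide_distrib)
qed

text \<open>
  The Fourier series converges uniformly, so it may be multiplied by \<open>h\<close> and integrated term by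
  term.
\<close>

lemma parseval:
  "(\<lambda>n. energy h (Suc n)) sums (integral {0..2 * pi} (\<lambda>t. (h t)\<^sup>2) / pi - (fourier_cos h 0)\<^sup>2 / 2)"
proof -
  obtain B where B: "\<And>t. t \<in> {0..2 * pi} \<Longrightarrow> \<bar>h t\<bar> \<le> B"
    using compact_imp_bounded[OF compact_continuous_image[OF cont compact_Icc]]
    by (force simp: bounded_iff)
  have B0: "B \<ge> 0" using B[of 0] by simp
  define M where "M n = B * (energy h' (Suc n) / 2 + inverse (real (Suc n) ^ 2))" for n
  have "summable (\<lambda>n. inverse (real (Suc n) ^ 2))"
    using inverse_power_summable[of 2, where 'a = real] by (subst summable_Suc_iff) simp
  then have M: "summable M"
    unfolding M_def by (intro summable_mult summable_add summable_divide summable_energy cont'_on)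
  have le: "\<bar>harmonic h (Suc n) t\<bar> \<le> energy h' (Suc n) / 2 + inverse (real (Suc n) ^ 2)" for n t
  proof -
    define m a b where "m = real (Suc n)" and "a = fourier_cos h (Suc n)" and "b = fourier_sin h (Suc n)"
    have m: "m > 0" by (simp add: m_def)
    \<comment> \<open>the summability of the coefficients comes from that of the energies of the derivative
        and of the inverse squares, by the arithmetic-geometric mean inequality\<close>
    have am: "\<bar>c\<bar> \<le> (m\<^sup>2 * c\<^sup>2 + inverse (m\<^sup>2)) / 2" for c
    proof -
      have "2 * \<bar>c\<bar> = 2 * (m * \<bar>c\<bar>) * inverse m" using m by simp
      also have "\<dots> \<le> (m * \<bar>c\<bar>)\<^sup>2 + (inverse m)\<^sup>2" by (rule sum_squares_bound)
      finally show ?thesis by (simp add: power_mult_distrib power_inverse)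
    qed
    have "\<bar>harmonic h (Suc n) t\<bar> \<le> \<bar>a * cos (m * t)\<bar> + \<bar>b * sin (m * t)\<bar>"
      unfolding harmonic_def a_def b_def m_def by (rule abs_triangle_ineq)
    also have "\<dots> \<le> \<bar>a\<bar> + \<bar>b\<bar>"
      by (intro add_mono) (simp_all add: abs_mult mult_left_le)
    also have "\<dots> \<le> m\<^sup>2 * (a\<^sup>2 + b\<^sup>2) / 2 + inverse (m\<^sup>2)"
      using am[of a] am[of b] by (simp add: algebra_simps add_divide_distrib)
    finally show ?thesis by (simp add: energy_deriv) (simp add: energy_def m_def a_def b_def)
  qed
  let ?L = "\<lambda>t. h t * (h t - fourier_cos h 0 / 2)"
  have lim: "uniform_limit {0..2 * pi} (\<lambda>N t. \<Sum>n<N. h t * harmonic h (Suc n) t) (\<lambda>t. \<Sum>n. h t * harmonic h (Suc n) t) sequentially"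
    by (rule Weierstrass_m_test[OF _ M]) (use B B0 le in \<open>auto simp: abs_mult M_def intro!: mult_mono\<close>)
  have "(\<lambda>n. h t * harmonic h (Suc n) t) sums ?L t" for t
    by (intro sums_mult fourier_series)
  then have "(\<lambda>t. \<Sum>n. h t * harmonic h (Suc n) t) = ?L"
    by (simp add: fun_eq_iff sums_iff)
  note lim = lim[unfolded this]
  have c: "continuous_on {0..2 * pi} (\<lambda>t. \<Sum>n<N. h t * harmonic h (Suc n) t)" for N
    by (intro continuous_intros cont)
  obtain I J where
    IJ: "\<And>N. ((\<lambda>t. \<Sum>n<N. h t * harmonic h (Suc n) t) has_integral I N) {0..2 * pi}"
    "(?L has_integral J) {0..2 * pi}" "I \<longlonglongrightarrow> J"
    by (rule uniform_limit_integral[OF lim c trivial_limit_sequentially]) (rule that)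
  have I: "I N = pi * (\<Sum>n<N. energy h (Suc n))" for N
  proof -
    have "I N = (\<Sum>n<N. integral {0..2 * pi} (\<lambda>t. h t * harmonic h (Suc n) t))"
      unfolding integral_unique[OF IJ(1), symmetric]
      by (intro integral_sum integrable_continuous_real continuous_intros cont) simp
    then show ?thesis
      by (simp add: integral_times_harmonic cont energy_def power2_eq_square sum_distrib_left)
  qed
  have J: "J = integral {0..2 * pi} (\<lambda>t. (h t)\<^sup>2) - pi * (fourier_cos h 0)\<^sup>2 / 2"
  proof -
    have "J = integral {0..2 * pi} (\<lambda>t. (h t)\<^sup>2 - fourier_cos h 0 / 2 * h t)"
      unfolding integral_unique[OF IJ(2), symmetric] by (simp add: power2_eq_square algebra_simps)
    also have "\<dots> = integral {0..2 * pi} (\<lambda>t. (h t)\<^sup>2) - integral {0..2 * pi} (\<lambda>t. fourier_cos h 0 / 2 * h t)"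
      by (intro integral_diff integrable_continuous_real continuous_intros cont)
    finally show ?thesis by (simp add: fourier_cos_def power2_eq_square)
  qed
  have "(\<lambda>N. I N / pi) \<longlonglongrightarrow> J / pi"
    by (intro tendsto_intros IJ(3)) simp
  then show ?thesis by (simp add: sums_def I J diff_divide_distrib)
qed

text \<open>
  In terms of energies, \<open>h\<close> contributes \<open>energy h n\<close> and \<open>h'\<close> contributes \<open>n\<^sup>2 * energy h n\<close>, so
  every harmonic of order at least \<open>k\<close> helps the inequality.  The second summand on the left keeps
  track of the surplus of one harmonic \<open>m\<close>, which is what decides the equality case.
  Parseval evaluates the integral of \<open>h\<^sup>2\<close>; Bessel's inequality bounds the energies of \<open>h'\<close>.
\<close>

lemma wirtinger_defect:
  assumes mean: "fourier_cos h 0 = 0"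
    and low: "\<And>n. 0 < n \<Longrightarrow> n < k \<Longrightarrow> energy h n = 0"
    and "m > 0"
  shows "(real k)\<^sup>2 * integral {0..2 * pi} (\<lambda>t. (h t)\<^sup>2) + pi * (((real m)\<^sup>2 - (real k)\<^sup>2) * energy h m)
     \<le> integral {0..2 * pi} (\<lambda>t. (h' t)\<^sup>2)"
proof -
  let ?d = "((real m)\<^sup>2 - (real k)\<^sup>2) * energy h m"
  obtain j where j: "m = Suc j" using \<open>m > 0\<close> gr0_conv_Suc by blast
  have s1: "(\<lambda>n. (real k)\<^sup>2 * energy h (Suc n)) sums ((real k)\<^sup>2 * (integral {0..2 * pi} (\<lambda>t. (h t)\<^sup>2) / pi))"
    using sums_mult[OF parseval] mean by simp
  have s2: "(\<lambda>n. if n = j then ?d else 0) sums ?d" by (rule sums_single)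
  have s3: "(\<lambda>n. energy h' (Suc n)) sums (\<Sum>n. energy h' (Suc n))"
    using summable_energy[OF cont'_on] by (rule summable_sums)
  have "(real k)\<^sup>2 * (integral {0..2 * pi} (\<lambda>t. (h t)\<^sup>2) / pi) + ?d \<le> (\<Sum>n. energy h' (Suc n))"
  proof (rule sums_le[OF _ sums_add[OF s1 s2] s3])
    fix n
    show "(real k)\<^sup>2 * energy h (Suc n) + (if n = j then ?d else 0) \<le> energy h' (Suc n)"
    proof (cases "Suc n < k")
      case True then show ?thesis using low[of "Suc n"] by (auto simp: energy_deriv j)
    next
      case False
      then have "(real k)\<^sup>2 * energy h (Suc n) \<le> (real (Suc n))\<^sup>2 * energy h (Suc n)"
        by (intro mult_right_mono power_mono energy_nonneg) auto
      then show ?thesis by (simp add: energy_deriv j algebra_simps)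
    qed
  qed
  also have "\<dots> \<le> integral {0..2 * pi} (\<lambda>t. (h' t)\<^sup>2) / pi"
    by (intro suminf_le_const summable_energy cont'_on energy_partial_sum_le)
  finally have "pi * ((real k)\<^sup>2 * (integral {0..2 * pi} (\<lambda>t. (h t)\<^sup>2) / pi) + ?d)
      \<le> pi * (integral {0..2 * pi} (\<lambda>t. (h' t)\<^sup>2) / pi)"
    by (rule mult_left_mono) simp
  then show ?thesis by (simp add: distrib_left)
qed

text \<open>
  The case \<open>m = k\<close> of the previous lemma is the inequality.  If equality holds, the other cases
  annihilate the energy of every order but \<open>k\<close>, and the Fourier series reduces to one term.
\<close>

lemma wirtinger:
  assumes mean: "fourier_cos h 0 = 0"
    and low: "\<And>n. 0 < n \<Longrightarrow> n < k \<Longrightarrow> energy h n = 0"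
    and "k > 0"
  shows "(real k)\<^sup>2 * integral {0..2 * pi} (\<lambda>t. (h t)\<^sup>2) \<le> integral {0..2 * pi} (\<lambda>t. (h' t)\<^sup>2)"
    and "(real k)\<^sup>2 * integral {0..2 * pi} (\<lambda>t. (h t)\<^sup>2) = integral {0..2 * pi} (\<lambda>t. (h' t)\<^sup>2)
      \<Longrightarrow> h = harmonic h k"
proof -
  have defect: "(real k)\<^sup>2 * integral {0..2 * pi} (\<lambda>t. (h t)\<^sup>2) + pi * (((real m)\<^sup>2 - (real k)\<^sup>2) * energy h m)
     \<le> integral {0..2 * pi} (\<lambda>t. (h' t)\<^sup>2)" if "m > 0" for m
    using wirtinger_defect[of k m] mean low that by blast
  show "(real k)\<^sup>2 * integral {0..2 * pi} (\<lambda>t. (h t)\<^sup>2) \<le> integral {0..2 * pi} (\<lambda>t. (h' t)\<^sup>2)"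
    using defect[of k] \<open>k > 0\<close> by simp
  assume eq: "(real k)\<^sup>2 * integral {0..2 * pi} (\<lambda>t. (h t)\<^sup>2) = integral {0..2 * pi} (\<lambda>t. (h' t)\<^sup>2)"
  have zero: "energy h n = 0" if "n > 0" "n \<noteq> k" for n
  proof (cases "n < k")
    case False
    then have "(real n)\<^sup>2 - (real k)\<^sup>2 > 0" using that by (simp add: power_strict_mono)
    moreover have "((real n)\<^sup>2 - (real k)\<^sup>2) * energy h n \<le> 0"
      using defect[of n] eq that(1) pi_gt_zero by (auto simp: mult_le_0_iff[of pi])
    moreover have "\<not> n \<le> k" using False that(2) by simp
    ultimately show ?thesis using energy_nonneg[of h n] by (simp add: mult_le_0_iff)
  qed (use low that in auto)
  have harm: "harmonic h (Suc n) t = (if n = k - 1 then harmonic h k t else 0)" for n t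
    using zero[of "Suc n"] \<open>k > 0\<close> by (auto simp: harmonic_def energy_def sum_power2_eq_zero_iff)
  have "(\<lambda>n. if n = k - 1 then harmonic h k t else 0) sums h t" for t
    using fourier_series[of t] mean unfolding harm by simp
  then have "h t = harmonic h k t" for t
    using sums_unique2 sums_single[of "k - 1" "\<lambda>_. harmonic h k t"] by blast
  then show "h = harmonic h k" by blast
qed

end


section \<open>The support function of an oval\<close>

lemma unit_vec_props [simp]:
  "norm (unit_vec \<theta>) = 1" "norm (rot90 v) = norm v" "unit_vec \<theta> \<bullet> unit_vec \<theta> = 1"
  "rot90 v \<bullet> rot90 w = v \<bullet> w" "v \<bullet> rot90 v = 0" "rot90 v \<bullet> v = 0" "rot90 (rot90 v) = - v"
  by (cases v; cases w; simp add: unit_vec_def rot90_def norm_Pair inner_prod_def power2_eq_square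
      flip: power2_eq_square)+

lemma unit_vec_2pi: "unit_vec (\<theta> + 2 * pi) = unit_vec \<theta>"
  by (simp add: unit_vec_def)

lemma plane_decomp: "v = (v \<bullet> unit_vec \<theta>) *\<^sub>R unit_vec \<theta> + (v \<bullet> rot90 (unit_vec \<theta>)) *\<^sub>R rot90 (unit_vec \<theta>)"
proof -
  obtain x y where v: "v = (x, y)" by (cases v)
  show ?thesis
    using pyth[of x \<theta>] pyth[of y \<theta>] by (simp add: v unit_vec_def rot90_def algebra_simps)
qed

lemma has_vector_derivative_unit_vec:
  "(unit_vec has_vector_derivative rot90 (unit_vec \<theta>)) (at \<theta>)"
  unfolding unit_vec_def[abs_def] rot90_def fst_conv snd_conv
  by (intro has_vector_derivative_Pair)
     (auto intro!: derivative_eq_intros simp flip: has_real_derivative_iff_has_vector_derivative)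

lemma has_vector_derivative_rot90_unit_vec:
  "((\<lambda>\<theta>. rot90 (unit_vec \<theta>)) has_vector_derivative - unit_vec \<theta>) (at \<theta>)"
  unfolding unit_vec_def[abs_def] rot90_def fst_conv snd_conv uminus_Pair
  by (intro has_vector_derivative_Pair)
     (auto intro!: derivative_eq_intros simp flip: has_real_derivative_iff_has_vector_derivative)

lemma unit_vec_eq_imp:
  assumes "unit_vec \<theta> = unit_vec \<phi>"
  obtains k :: int where "\<theta> = \<phi> + 2 * pi * of_int k"
  using assms sin_cos_eq_iff[of \<theta> \<phi>] by (auto simp: unit_vec_def mult_ac)

text \<open>
  On an oval the outer normal angle is a regular parameter.  Passing to it turns the smoothness of
  the curve into a second derivative of the support function.
\<close>

locale oval_domain =
  fixes K :: "plane set" and \<gamma> :: "real \<Rightarrow> plane"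
  assumes scd: "strictly_convex_domain K" and oval: "oval \<gamma>" and fr: "frontier K = path_image \<gamma>"
begin

definition speed :: "real \<Rightarrow> real" where "speed t = norm (vderiv \<gamma> t)"
definition turning :: "real \<Rightarrow> real" where
  "turning t = det2 (vderiv \<gamma> t) (vderiv (vderiv \<gamma>) t) / (speed t)\<^sup>2"

lemma speed_pos: "speed t > 0"
  using oval by (simp add: speed_def oval_def)

lemma turning_pos: "turning t > 0"
proof -
  have "turning t = curvature \<gamma> t * speed t"
    using speed_pos[of t] by (simp add: turning_def curvature_def speed_def power2_eq_square power3_eq_cube)
  then show ?thesis using speed_pos oval by (simp add: oval_def)
qed

lemma curve_derivs:
  "(\<gamma> has_vector_derivative vderiv \<gamma> t) (at t)"
  "(vderiv \<gamma> has_vector_derivative vderiv (vderiv \<gamma>) t) (at t)"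
  "continuous_on UNIV (vderiv (vderiv \<gamma>))"
proof -
  have sm: "(vderiv ^^ n) \<gamma> differentiable (at t)" for n t
    using oval by (auto simp: oval_def smooth_curve_def)
  show "(\<gamma> has_vector_derivative vderiv \<gamma> t) (at t)"
    using sm[of 0 t] by (simp add: vderiv_def vector_derivative_works)
  show "(vderiv \<gamma> has_vector_derivative vderiv (vderiv \<gamma>) t) (at t)"
    using sm[of 1 t] unfolding vderiv_def[of "vderiv \<gamma>"] by (simp add: vector_derivative_works)
  show "continuous_on UNIV (vderiv (vderiv \<gamma>))"
    using sm[of 2] by (auto simp: continuous_on_eq_continuous_at numeral_2_eq_2 intro: differentiable_imp_continuous_within)
qed

lemma continuous_vderiv: "continuous_on UNIV (vderiv \<gamma>)"
  using curve_derivs(2) by (auto simp: continuous_on_eq_continuous_at intro: has_vector_derivative_continuous)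

lemma continuous_speed: "continuous_on UNIV speed"
  unfolding speed_def[abs_def] by (intro continuous_intros continuous_vderiv)

lemma continuous_turning: "continuous_on UNIV turning"
  unfolding turning_def[abs_def] det2_def
  by (intro continuous_intros continuous_vderiv curve_derivs continuous_speed) (use speed_pos in \<open>simp add: less_imp_neq[symmetric]\<close>)

lemma vderiv_periodic: "vderiv \<gamma> (t + 1) = vderiv \<gamma> t" "vderiv (vderiv \<gamma>) (t + 1) = vderiv (vderiv \<gamma>) t"
proof -
  have shift: "((\<lambda>t. f (t + 1)) has_vector_derivative f' (t + 1)) (at t)"
    if "\<And>t. (f has_vector_derivative f' t) (at t)" for f f' :: "real \<Rightarrow> plane" and t
  proof -
    have "((\<lambda>t::real. t + 1) has_real_derivative 1) (at t)" by (auto intro!: derivative_eq_intros)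
    then show ?thesis
      using vector_diff_chain_at[of "\<lambda>t. t + 1" 1 t f "f' (t + 1)"] that
      by (simp add: o_def has_real_derivative_iff_has_vector_derivative)
  qed
  have *: "vderiv \<gamma> (t + 1) = vderiv \<gamma> t" for t
    using shift[of \<gamma> "vderiv \<gamma>", OF curve_derivs(1)] oval
    by (intro vector_derivative_unique_at[OF _ curve_derivs(1)]) (simp add: oval_def)
  show "vderiv \<gamma> (t + 1) = vderiv \<gamma> t" by (rule *)
  show "vderiv (vderiv \<gamma>) (t + 1) = vderiv (vderiv \<gamma>) t"
    using shift[of "vderiv \<gamma>" "vderiv (vderiv \<gamma>)", OF curve_derivs(2)]
    by (intro vector_derivative_unique_at[OF _ curve_derivs(2)]) (simp add: *)
qed

lemma turning_periodic: "turning (t + 1) = turning t"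
  by (simp add: turning_def speed_def vderiv_periodic)

text \<open>
  A differentiable choice of the outer normal angle: an antiderivative of the turning rate.  In
  the frame that rotates with this angle, the two coordinates of the velocity satisfy the same scalar
  linear differential equation \<open>y' = r * y\<close>; after multiplication by \<open>exp (- R)\<close> with \<open>R' = r\<close> they are
  constant, so the normal coordinate stays zero and the tangential one stays positive.
\<close>

lemma normal_angle_exists:
  obtains \<Theta> where "\<And>t. (\<Theta> has_real_derivative turning t) (at t)"
    "\<And>t. vderiv \<gamma> t = speed t *\<^sub>R rot90 (unit_vec (\<Theta> t))"
proof -
  define X Y X' Y' where "X t = fst (vderiv \<gamma> t)" and "Y t = snd (vderiv \<gamma> t)"
    and "X' t = fst (vderiv (vderiv \<gamma>) t)" and "Y' t = snd (vderiv (vderiv \<gamma>) t)" for t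
  have sp: "(speed t)\<^sup>2 = (X t)\<^sup>2 + (Y t)\<^sup>2" for t
    unfolding speed_def X_def Y_def by (cases "vderiv \<gamma> t") (simp add: norm_Pair)
  have sp0: "(X t)\<^sup>2 + (Y t)\<^sup>2 \<noteq> 0" for t
    using speed_pos[of t] by (simp flip: sp)
  have dX: "(X has_real_derivative X' t) (at t)" for t
    unfolding X_def[abs_def] X'_def has_real_derivative_iff_has_vector_derivative
    by (rule bounded_linear.has_vector_derivative[OF bounded_linear_fst curve_derivs(2)])
  have dY: "(Y has_real_derivative Y' t) (at t)" for t
    unfolding Y_def[abs_def] Y'_def has_real_derivative_iff_has_vector_derivative
    by (rule bounded_linear.has_vector_derivative[OF bounded_linear_snd curve_derivs(2)])
  define \<omega> where "\<omega> = turning"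
  define r where "r t = (X t * X' t + Y t * Y' t) / (speed t)\<^sup>2" for t
  have om: "\<omega> t = (X t * Y' t - Y t * X' t) / (speed t)\<^sup>2" for t
    by (simp add: \<omega>_def turning_def det2_def X_def Y_def X'_def Y'_def)
  have XY': "X' t = r t * X t - \<omega> t * Y t" "Y' t = r t * Y t + \<omega> t * X t" for t
  proof -
    have D: "r t * ((X t)\<^sup>2 + (Y t)\<^sup>2) = X t * X' t + Y t * Y' t"
      "\<omega> t * ((X t)\<^sup>2 + (Y t)\<^sup>2) = X t * Y' t - Y t * X' t"
      using sp0[of t] unfolding r_def om sp by simp_all
    have "(r t * X t - \<omega> t * Y t) * ((X t)\<^sup>2 + (Y t)\<^sup>2) =
        r t * ((X t)\<^sup>2 + (Y t)\<^sup>2) * X t - \<omega> t * ((X t)\<^sup>2 + (Y t)\<^sup>2) * Y t"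
      by (simp add: algebra_simps)
    also have "\<dots> = X' t * ((X t)\<^sup>2 + (Y t)\<^sup>2)"
      unfolding D by (simp add: algebra_simps power2_eq_square)
    finally show "X' t = r t * X t - \<omega> t * Y t"
      using mult_right_cancel[OF sp0[of t]] by metis
    have "(r t * Y t + \<omega> t * X t) * ((X t)\<^sup>2 + (Y t)\<^sup>2) =
        r t * ((X t)\<^sup>2 + (Y t)\<^sup>2) * Y t + \<omega> t * ((X t)\<^sup>2 + (Y t)\<^sup>2) * X t"
      by (simp add: algebra_simps)
    also have "\<dots> = Y' t * ((X t)\<^sup>2 + (Y t)\<^sup>2)"
      unfolding D by (simp add: algebra_simps power2_eq_square)
    finally show "Y' t = r t * Y t + \<omega> t * X t"
      using mult_right_cancel[OF sp0[of t]] by metis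
  qed
  have "continuous_on UNIV r"
    unfolding r_def[abs_def] X_def Y_def X'_def Y'_def
    by (intro continuous_intros continuous_vderiv curve_derivs continuous_speed) (use speed_pos in \<open>simp add: less_imp_neq[symmetric]\<close>)
  then obtain R where R: "\<And>t. (R has_real_derivative r t) (at t)"
    using continuous_has_antiderivative by blast
  obtain \<Theta>0 where \<Theta>0: "\<And>t. (\<Theta>0 has_real_derivative \<omega> t) (at t)"
    using continuous_has_antiderivative[OF continuous_turning] unfolding \<omega>_def by blast
  \<comment> \<open>\<open>a\<close> is the outer normal angle at the initial point: on a counterclockwise curve the outer normal
      is the velocity turned clockwise.\<close>
  have "rot90 (vderiv \<gamma> 0) \<noteq> 0"
    using speed_pos[of 0] by (metis norm_zero speed_def unit_vec_props(2) less_irrefl)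
  then obtain a where a: "- rot90 (vderiv \<gamma> 0) = speed 0 *\<^sub>R unit_vec a"
    using unit_vec_exhaust[of "- rot90 (vderiv \<gamma> 0)"] by (auto simp: speed_def)
  have a': "X 0 = - (speed 0 * sin a)" "Y 0 = speed 0 * cos a"
    using a by (simp_all add: rot90_def unit_vec_def X_def Y_def prod_eq_iff)
  define \<Theta> where "\<Theta> t = \<Theta>0 t + (a - \<Theta>0 0)" for t
  have \<Theta>: "(\<Theta> has_real_derivative \<omega> t) (at t)" for t
    using \<Theta>0 unfolding \<Theta>_def[abs_def] by (auto intro!: derivative_eq_intros)
  have \<Theta>_0: "\<Theta> 0 = a" by (simp add: \<Theta>_def)
  define A where "A t = (X t * cos (\<Theta> t) + Y t * sin (\<Theta> t)) * exp (- R t)" for t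
  define B where "B t = (Y t * cos (\<Theta> t) - X t * sin (\<Theta> t)) * exp (- R t)" for t
  have "(A has_real_derivative 0) (at t)" for t
    unfolding A_def[abs_def]
    by (rule derivative_eq_intros dX dY \<Theta> R refl)+ (simp add: XY' algebra_simps)
  then have A: "A t = A 0" for t using DERIV_isconst_all[of A t 0] by blast
  have "(B has_real_derivative 0) (at t)" for t
    unfolding B_def[abs_def]
    by (rule derivative_eq_intros dX dY \<Theta> R refl)+ (simp add: XY' algebra_simps)
  then have B: "B t = B 0" for t using DERIV_isconst_all[of B t 0] by blast
  have "A 0 = 0" by (simp add: A_def \<Theta>_0 a' algebra_simps)
  then have A0: "X t * cos (\<Theta> t) + Y t * sin (\<Theta> t) = 0" for t
    using A[of t] by (simp add: A_def)
  have "B 0 = speed 0 * exp (- R 0)"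
    using pyth[of "speed 0" a] by (simp add: B_def \<Theta>_0 a' algebra_simps)
  then have "B t > 0" for t using B[of t] speed_pos[of 0] by simp
  then have B0: "Y t * cos (\<Theta> t) - X t * sin (\<Theta> t) > 0" for t
    by (simp add: B_def zero_less_mult_iff)
  have "vderiv \<gamma> t = speed t *\<^sub>R rot90 (unit_vec (\<Theta> t))" for t
  proof -
    let ?b = "vderiv \<gamma> t \<bullet> rot90 (unit_vec (\<Theta> t))"
    have "vderiv \<gamma> t \<bullet> unit_vec (\<Theta> t) = 0" "?b > 0"
      using A0[of t] B0[of t] by (simp_all add: X_def Y_def unit_vec_def rot90_def inner_prod_def)
    then have eq: "vderiv \<gamma> t = ?b *\<^sub>R rot90 (unit_vec (\<Theta> t))"
      using plane_decomp[of "vderiv \<gamma> t" "\<Theta> t"] by simp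
    then have "speed t = \<bar>?b\<bar>" unfolding speed_def by (metis norm_scaleR unit_vec_props(1,2) mult.right_neutral)
    then show ?thesis using eq \<open>?b > 0\<close> by simp
  qed
  then show thesis using that \<Theta> unfolding \<omega>_def by blast
qed


lemma support_pt_2pi: "support_pt K (\<theta> + 2 * pi) = support_pt K \<theta>"
  by (rule support_pt_cong[OF scd]) (rule unit_vec_2pi)

text \<open>
  Every point of the oval is a support point for some angle, and the tangent there determines the
  angle up to full turns.
\<close>

lemma curve_eq_support_pt:
  assumes "vderiv \<gamma> t = speed t *\<^sub>R rot90 (unit_vec \<phi>)"
  shows "\<gamma> t = support_pt K \<phi>"
proof -
  obtain \<theta> where \<theta>: "\<gamma> t = support_pt K \<theta>"
    using frontier_support_pt[OF scd oval_in_frontier[OF scd oval fr]] by metis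
  obtain c where c: "c > 0" "vderiv \<gamma> t = c *\<^sub>R rot90 (unit_vec \<theta>)"
    using oval_tangent[OF scd oval fr \<theta>] .
  have "speed t = c" unfolding speed_def c(2) using c(1) by simp
  then have "rot90 (unit_vec \<phi>) = rot90 (unit_vec \<theta>)" using assms c by simp
  then have "unit_vec \<phi> = unit_vec \<theta>" by (simp add: rot90_def prod_eq_iff)
  then show ?thesis using support_pt_cong[OF scd] \<theta> by metis
qed

text \<open>
  Over one period the normal angle grows by a positive multiple of \<open>2 * pi\<close>.  If it were more than
  one full turn, the curve would meet the support point of its initial angle again in between,
  against simplicity.
\<close>

lemma normal_angle:
  obtains \<Theta> where "\<And>t. (\<Theta> has_real_derivative turning t) (at t)"
    "\<And>t. vderiv \<gamma> t = speed t *\<^sub>R rot90 (unit_vec (\<Theta> t))"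
    "\<And>t. \<gamma> t = support_pt K (\<Theta> t)"
    "\<And>t. \<Theta> (t + 1) = \<Theta> t + 2 * pi"
proof -
  obtain \<Theta> where \<Theta>: "\<And>t. (\<Theta> has_real_derivative turning t) (at t)"
    and v: "\<And>t. vderiv \<gamma> t = speed t *\<^sub>R rot90 (unit_vec (\<Theta> t))"
    using normal_angle_exists by blast
  note g = curve_eq_support_pt[OF v]
  have contT: "continuous_on A \<Theta>" for A
    using \<Theta> by (rule continuous_on_if_derivative)
  have mono: "\<Theta> s < \<Theta> t" if "s < t" for s t
    using DERIV_pos_imp_increasing[OF that, of \<Theta>] \<Theta> turning_pos by blast
  have "((\<lambda>t. \<Theta> (t + 1) - \<Theta> t) has_real_derivative 0) (at t)" for t
    using \<Theta>[of t] \<Theta>[of "t + 1"] unfolding DERIV_shift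
    by (auto intro!: derivative_eq_intros simp: turning_periodic)
  then have const: "\<Theta> (t + 1) - \<Theta> t = \<Theta> 1 - \<Theta> 0" for t
    using DERIV_isconst_all[of "\<lambda>t. \<Theta> (t + 1) - \<Theta> t" t 0] by simp
  have v1: "vderiv \<gamma> 1 = vderiv \<gamma> 0" using vderiv_periodic(1)[of 0] by simp
  then have "speed 1 = speed 0" by (simp add: speed_def)
  then have "speed 0 *\<^sub>R rot90 (unit_vec (\<Theta> 1)) = speed 0 *\<^sub>R rot90 (unit_vec (\<Theta> 0))"
    using v1 unfolding v by simp
  then have "rot90 (unit_vec (\<Theta> 1)) = rot90 (unit_vec (\<Theta> 0))"
    using speed_pos[of 0] by simp
  then have "unit_vec (\<Theta> 1) = unit_vec (\<Theta> 0)" by (simp add: rot90_def prod_eq_iff)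
  then obtain k :: int where k: "\<Theta> 1 = \<Theta> 0 + 2 * pi * of_int k" by (rule unit_vec_eq_imp)
  have "0 < 2 * pi * of_int k" using mono[of 0 1] k by simp
  then have "k > 0" by (simp add: zero_less_mult_iff)
  moreover have "\<not> k \<ge> 2"
  proof
    assume "k \<ge> 2"
    then have "2 * pi * 1 < 2 * pi * of_int k" by (intro mult_strict_left_mono) auto
    then have lt: "\<Theta> 0 + 2 * pi < \<Theta> 1" using k by simp
    then obtain s where s: "0 \<le> s" "s \<le> 1" "\<Theta> s = \<Theta> 0 + 2 * pi"
      using IVT'[of \<Theta> 0 "\<Theta> 0 + 2 * pi" 1] contT by force
    then have "\<gamma> s = \<gamma> 0" using g[of s] g[of 0] support_pt_2pi by simp
    moreover have "s \<noteq> 0" "s \<noteq> 1" using s lt by auto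
    moreover have "simple_path \<gamma>" using oval by (simp add: oval_def)
    ultimately show False using s(1,2) unfolding simple_path_def loop_free_def by force
  qed
  ultimately have "\<Theta> 1 - \<Theta> 0 = 2 * pi" using k by simp
  then have "\<Theta> (t + 1) = \<Theta> t + 2 * pi" for t using const[of t] by simp
  then show thesis using that \<Theta> v g by blast
qed

text \<open>
  The normal angle is a strictly increasing bijection of the line with positive derivative.  Hence
  the support point is the curve reparametrized by the inverse of the normal angle, and its velocity
  is the radius of curvature times the unit tangent.
\<close>

lemma support_pt_C1:
  obtains \<rho> where "\<And>\<theta>. \<rho> \<theta> > 0" "continuous_on UNIV \<rho>"
    "\<And>\<theta>. (support_pt K has_vector_derivative \<rho> \<theta> *\<^sub>R rot90 (unit_vec \<theta>)) (at \<theta>)"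
proof -
  obtain \<Theta> where \<Theta>: "\<And>t. (\<Theta> has_real_derivative turning t) (at t)"
    and v: "\<And>t. vderiv \<gamma> t = speed t *\<^sub>R rot90 (unit_vec (\<Theta> t))"
    and g: "\<And>t. \<gamma> t = support_pt K (\<Theta> t)"
    and per: "\<And>t. \<Theta> (t + 1) = \<Theta> t + 2 * pi"
    using normal_angle by blast
  have contT: "continuous_on A \<Theta>" for A
    using \<Theta> by (rule continuous_on_if_derivative)
  have mono: "\<Theta> s < \<Theta> t" if "s < t" for s t
    using DERIV_pos_imp_increasing[OF that, of \<Theta>] \<Theta> turning_pos by blast
  then have inj: "inj \<Theta>" by (intro linorder_injI) (metis less_irrefl)
  have up: "\<Theta> (real n) = \<Theta> 0 + 2 * pi * real n" for n
  proof (induction n)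
    case (Suc n)
    have "real (Suc n) = real n + 1" by simp
    then show ?case using per[of "real n"] Suc.IH by (simp add: algebra_simps)
  qed simp
  have down: "\<Theta> (- real n) = \<Theta> 0 - 2 * pi * real n" for n
  proof (induction n)
    case (Suc n)
    have "- real n = - real (Suc n) + 1" by simp
    then show ?case using per[of "- real (Suc n)"] Suc.IH by (simp add: algebra_simps)
  qed simp
  have "\<exists>t. \<Theta> t = \<theta>" for \<theta>
  proof -
    obtain n where n: "\<bar>\<theta> - \<Theta> 0\<bar> \<le> real n" using real_arch_simple by blast
    have "real n \<le> 2 * pi * real n" using pi_ge_two by (simp add: mult_le_cancel_right1)
    then have "\<Theta> (- real n) \<le> \<theta>" "\<theta> \<le> \<Theta> (real n)" using n unfolding up down by linarith+
    then show ?thesis using IVT'[of \<Theta> "- real n" \<theta> "real n"] contT by force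
  qed
  then have surj: "surj \<Theta>" by (metis surjI)
  define \<Psi> where "\<Psi> = inv \<Theta>"
  have \<Psi>1: "\<Theta> (\<Psi> \<theta>) = \<theta>" for \<theta> by (simp add: \<Psi>_def surj surj_f_inv_f)
  have \<Psi>2: "\<Psi> (\<Theta> t) = t" for t by (simp add: \<Psi>_def inj)
  have isC: "isCont \<Psi> \<theta>" for \<theta>
  proof -
    have "isCont \<Psi> (\<Theta> (\<Psi> \<theta>))"
      by (rule isCont_inverse_function2[of "\<Psi> \<theta> - 1" "\<Psi> \<theta>" "\<Psi> \<theta> + 1"])
         (use \<Psi>2 DERIV_isCont[OF \<Theta>] in auto)
    then show ?thesis by (simp add: \<Psi>1)
  qed
  have d\<Psi>: "(\<Psi> has_real_derivative inverse (turning (\<Psi> \<theta>))) (at \<theta>)" for \<theta>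
    by (rule DERIV_inverse_function[of \<Theta> _ _ _ "\<theta> - 1" "\<theta> + 1"])
       (use \<Theta> isC \<Psi>1 turning_pos[of "\<Psi> \<theta>"] in auto)
  have cont\<Psi>: "continuous_on UNIV \<Psi>" using isC by (simp add: continuous_on_eq_continuous_at)
  define \<rho> where "\<rho> \<theta> = speed (\<Psi> \<theta>) / turning (\<Psi> \<theta>)" for \<theta>
  show thesis
  proof
    show "\<rho> \<theta> > 0" for \<theta> by (simp add: \<rho>_def speed_pos turning_pos)
    have "turning t \<noteq> 0" for t using turning_pos[of t] by simp
    then show "continuous_on UNIV \<rho>" unfolding \<rho>_def[abs_def]
      by (intro continuous_intros continuous_on_compose2[OF continuous_speed cont\<Psi>]
           continuous_on_compose2[OF continuous_turning cont\<Psi>]) auto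
    fix \<theta>
    have "support_pt K = \<gamma> \<circ> \<Psi>" using g \<Psi>1 by (auto simp: fun_eq_iff)
    moreover have "(\<gamma> \<circ> \<Psi> has_vector_derivative inverse (turning (\<Psi> \<theta>)) *\<^sub>R vderiv \<gamma> (\<Psi> \<theta>)) (at \<theta>)"
      by (rule vector_diff_chain_at[OF _ curve_derivs(1)])
         (use d\<Psi> in \<open>simp add: has_real_derivative_iff_has_vector_derivative\<close>)
    moreover have "inverse (turning (\<Psi> \<theta>)) *\<^sub>R vderiv \<gamma> (\<Psi> \<theta>) = \<rho> \<theta> *\<^sub>R rot90 (unit_vec \<theta>)"
      unfolding v[of "\<Psi> \<theta>"] \<Psi>1 by (simp add: \<rho>_def divide_inverse mult.commute)
    ultimately show "(support_pt K has_vector_derivative \<rho> \<theta> *\<^sub>R rot90 (unit_vec \<theta>)) (at \<theta>)" by simp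
  qed
qed

lemma radius_exists: "\<exists>\<rho>. (\<forall>\<theta>. \<rho> \<theta> > 0) \<and> continuous_on UNIV \<rho> \<and>
    (\<forall>\<theta>. (support_pt K has_vector_derivative \<rho> \<theta> *\<^sub>R rot90 (unit_vec \<theta>)) (at \<theta>))"
  by (rule support_pt_C1) blast

text \<open>The radius of curvature as a function of the normal angle.\<close>

definition radius :: "real \<Rightarrow> real" where
  "radius = (SOME \<rho>. (\<forall>\<theta>. \<rho> \<theta> > 0) \<and> continuous_on UNIV \<rho> \<and>
    (\<forall>\<theta>. (support_pt K has_vector_derivative \<rho> \<theta> *\<^sub>R rot90 (unit_vec \<theta>)) (at \<theta>)))"

lemma radius:
  "radius \<theta> > 0" "continuous_on UNIV radius"
  "(support_pt K has_vector_derivative radius \<theta> *\<^sub>R rot90 (unit_vec \<theta>)) (at \<theta>)"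
proof -
  have "(\<forall>\<theta>. radius \<theta> > 0) \<and> continuous_on UNIV radius \<and>
    (\<forall>\<theta>. (support_pt K has_vector_derivative radius \<theta> *\<^sub>R rot90 (unit_vec \<theta>)) (at \<theta>))"
    unfolding radius_def by (rule someI_ex[OF radius_exists])
  then show "radius \<theta> > 0" "continuous_on UNIV radius"
    "(support_pt K has_vector_derivative radius \<theta> *\<^sub>R rot90 (unit_vec \<theta>)) (at \<theta>)" by auto
qed

text \<open>
  The coordinates of the support point in the frame of the outer normal and the tangent; the first
  one is the support function by \<open>p_support_pt\<close>.
\<close>

definition p :: "real \<Rightarrow> real" where "p = supp_fun (frontier K)"
definition p' :: "real \<Rightarrow> real" where "p' \<theta> = support_pt K \<theta> \<bullet> rot90 (unit_vec \<theta>)"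

lemma p_support_pt: "p \<theta> = support_pt K \<theta> \<bullet> unit_vec \<theta>"
  by (simp add: p_def supp_fun_support_pt[OF scd])

lemma deriv_p: "(p has_real_derivative p' \<theta>) (at \<theta>)"
  unfolding p_def p'_def by (rule supp_fun_deriv[OF scd])

lemma deriv_p': "(p' has_real_derivative radius \<theta> - p \<theta>) (at \<theta>)"
proof -
  have "(p' has_vector_derivative support_pt K \<theta> \<bullet> - unit_vec \<theta> +
      (radius \<theta> *\<^sub>R rot90 (unit_vec \<theta>)) \<bullet> rot90 (unit_vec \<theta>)) (at \<theta>)"
    unfolding p'_def[abs_def]
    by (rule bounded_bilinear.has_vector_derivative[OF bounded_bilinear_inner radius(3) has_vector_derivative_rot90_unit_vec])
  then show ?thesis
    by (simp add: has_real_derivative_iff_has_vector_derivative p_support_pt)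
qed

sublocale p: periodic_C1 p p'
proof
  show "continuous_on UNIV p'"
    using deriv_p' by (rule continuous_on_if_derivative)
qed (simp_all add: deriv_p p_support_pt support_pt_2pi unit_vec_2pi)

text \<open>
  Cauchy's formula for the perimeter.  The speed is the derivative of the tangential coordinate of
  the curve, which is periodic, plus the support function times the rate of the normal angle.
\<close>

lemma curve_length_eq: "curve_length \<gamma> = integral {0..2 * pi} p"
proof -
  obtain \<Theta> where \<Theta>: "\<And>t. (\<Theta> has_real_derivative turning t) (at t)"
    and v: "\<And>t. vderiv \<gamma> t = speed t *\<^sub>R rot90 (unit_vec (\<Theta> t))"
    and g: "\<And>t. \<gamma> t = support_pt K (\<Theta> t)"
    and per: "\<And>t. \<Theta> (t + 1) = \<Theta> t + 2 * pi"
    using normal_angle by blast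
  obtain P where P: "\<And>t. (P has_real_derivative p t) (at t)"
    using continuous_has_antiderivative[OF p.cont] by blast
  \<comment> \<open>an antiderivative of the speed\<close>
  define H where "H t = \<gamma> t \<bullet> rot90 (unit_vec (\<Theta> t)) + P (\<Theta> t)" for t
  have H: "(H has_real_derivative speed t) (at t)" for t
  proof -
    have 1: "((\<lambda>t. rot90 (unit_vec (\<Theta> t))) has_vector_derivative turning t *\<^sub>R - unit_vec (\<Theta> t)) (at t)"
      using vector_diff_chain_at[OF _ has_vector_derivative_rot90_unit_vec, of \<Theta> "turning t" t] \<Theta>
      by (simp add: o_def has_real_derivative_iff_has_vector_derivative)
    have 2: "((\<lambda>t. P (\<Theta> t)) has_real_derivative p (\<Theta> t) * turning t) (at t)"
      by (rule DERIV_chain2[OF P \<Theta>])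
    have "(H has_vector_derivative (\<gamma> t \<bullet> (turning t *\<^sub>R - unit_vec (\<Theta> t)) +
       vderiv \<gamma> t \<bullet> rot90 (unit_vec (\<Theta> t))) + p (\<Theta> t) * turning t) (at t)"
      unfolding H_def[abs_def]
      by (intro has_vector_derivative_add bounded_bilinear.has_vector_derivative[OF bounded_bilinear_inner curve_derivs(1) 1]
           2[unfolded has_real_derivative_iff_has_vector_derivative])
    then show ?thesis
      unfolding v g p_support_pt by (simp add: has_real_derivative_iff_has_vector_derivative)
  qed
  have "(speed has_integral (H 1 - H 0)) {0..1}"
    by (intro integral_FTC_real H) simp
  moreover have "\<Theta> 1 = \<Theta> 0 + 2 * pi" using per[of 0] by simp
  then have "H 1 - H 0 = P (2 * pi + \<Theta> 0) - P (0 + \<Theta> 0)"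
    by (simp add: H_def g support_pt_2pi unit_vec_2pi add.commute)
  moreover have "((\<lambda>t. P (t + \<Theta> 0)) has_real_derivative p (t + \<Theta> 0)) (at t)" for t
    using P[of "t + \<Theta> 0"] unfolding DERIV_shift .
  then have "((\<lambda>t. p (t + \<Theta> 0)) has_integral (P (2 * pi + \<Theta> 0) - P (0 + \<Theta> 0))) {0..2 * pi}"
    by (intro integral_FTC_real) auto
  ultimately have "curve_length \<gamma> = integral {0..2 * pi} (\<lambda>t. p (t + \<Theta> 0))"
    by (simp add: curve_length_def speed_def[abs_def] integral_unique)
  then show ?thesis using integral_periodic_shift[OF p.cont p.periodic] by simp
qed

end


section \<open>Area, symmetral and Constant Width Measure Set\<close>

text \<open>
  An arc on which the abscissa is injective is the graph of a continuous function, and the signed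
  area below it can be computed along the arc.
\<close>

lemma monotone_arc_is_graph:
  fixes X X' Y :: "real \<Rightarrow> real"
  assumes "a \<le> b" and X: "\<And>t. (X has_real_derivative X' t) (at t)" and inj: "inj_on X {a..b}"
    and Y: "continuous_on {a..b} Y" and img: "X ` {a..b} = {c..d}"
  obtains f where "continuous_on {c..d} f" "\<And>t. t \<in> {a..b} \<Longrightarrow> f (X t) = Y t"
    "integral {a..b} (\<lambda>t. X' t * Y t) = integral {X a..X b} f - integral {X b..X a} f"
proof -
  have cX: "continuous_on {a..b} X" using X by (rule continuous_on_if_derivative)
  define g where "g = the_inv_into {a..b} X"
  have g: "g (X t) = t" if "t \<in> {a..b}" for t using that inj by (simp add: g_def the_inv_into_f_f)
  have "continuous_on (X ` {a..b}) g"
    by (rule continuous_on_inv[OF cX compact_Icc]) (simp add: g)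
  then have cg: "continuous_on {c..d} g" by (simp add: img)
  define f where "f x = Y (g x)" for x
  have cf: "continuous_on {c..d} f"
    unfolding f_def by (rule continuous_on_compose2[OF Y cg]) (use g in \<open>auto simp flip: img\<close>)
  have fX: "f (X t) = Y t" if "t \<in> {a..b}" for t using that by (simp add: f_def g)
  have "((\<lambda>t. X' t *\<^sub>R f (X t)) has_integral (integral {X a..X b} f - integral {X b..X a} f)) {a..b}"
    by (rule has_integral_substitution_general[OF _ assms(1) _ cf cX, of "{}"])
       (simp_all add: img has_field_derivative_at_within[OF X])
  moreover have "integral {a..b} (\<lambda>t. X' t *\<^sub>R f (X t)) = integral {a..b} (\<lambda>t. X' t * Y t)"
    by (rule integral_cong) (simp add: fX)
  ultimately have "integral {a..b} (\<lambda>t. X' t * Y t) = integral {X a..X b} f - integral {X b..X a} f"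
    by (simp add: integral_unique)
  then show thesis using that cf fX by blast
qed

lemma supp_fun_frontier_eq:
  assumes "compact N" "x \<in> N" "\<And>y. y \<in> N \<Longrightarrow> y \<bullet> unit_vec \<theta> \<le> x \<bullet> unit_vec \<theta>"
  shows "supp_fun (frontier N) \<theta> = x \<bullet> unit_vec \<theta>"
proof -
  have cl: "closed N" using assms(1) by (rule compact_imp_closed)
  have "x \<notin> interior N"
    using interior_not_max[of x N "unit_vec \<theta>"] assms(3) by (metis not_le unit_vec_nz)
  then have "x \<in> frontier N" using assms(2) cl by (simp add: frontier_def)
  moreover have "frontier N \<subseteq> N" using cl by (rule frontier_subset_closed)
  ultimately show ?thesis
    unfolding supp_fun_def using assms(3) by (intro cSup_eq_maximum) auto
qed

context oval_domain
begin

lemma support_pt_in: "support_pt K \<theta> \<in> K"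
  using support_pt[OF scd, of \<theta>] by (simp add: is_support_pt_def)

lemma support_pt_max: "y \<in> K \<Longrightarrow> y \<bullet> unit_vec \<theta> \<le> p \<theta>"
  using support_pt[OF scd, of \<theta>] by (simp add: is_support_pt_def p_support_pt)

lemma deriv_coords:
  "((\<lambda>\<theta>. fst (support_pt K \<theta>)) has_real_derivative - (radius \<theta> * sin \<theta>)) (at \<theta>)"
  "((\<lambda>\<theta>. snd (support_pt K \<theta>)) has_real_derivative radius \<theta> * cos \<theta>) (at \<theta>)"
  using bounded_linear.has_vector_derivative[OF bounded_linear_fst radius(3)[of \<theta>]]
    bounded_linear.has_vector_derivative[OF bounded_linear_snd radius(3)[of \<theta>]]
  by (simp_all add: has_real_derivative_iff_has_vector_derivative rot90_def unit_vec_def)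

text \<open>
  The body lies between two graphs over the interval \<open>{c..d}\<close> of its abscissae: the arc of the
  normal angles in \<open>{0..pi}\<close>, run through from right to left, is the upper one, and the arc of the
  angles in \<open>{pi..2 * pi}\<close>, from left to right, is the lower one.  By Fubini the area is the
  integral of the length of the vertical slices.
\<close>

lemma area_contour: "measure lebesgue K = - integral {0..2 * pi} (\<lambda>\<theta>. - (radius \<theta> * sin \<theta>) * snd (support_pt K \<theta>))"
proof -
  define X Y X' where "X \<theta> = fst (support_pt K \<theta>)" and "Y \<theta> = snd (support_pt K \<theta>)"
    and "X' \<theta> = - (radius \<theta> * sin \<theta>)" for \<theta>
  have XY: "support_pt K \<theta> = (X \<theta>, Y \<theta>)" for \<theta> by (simp add: X_def Y_def)
  have dX: "(X has_real_derivative X' \<theta>) (at \<theta>)" for \<theta>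
    unfolding X_def X'_def by (rule deriv_coords)
  have cX: "continuous_on A X" for A using dX by (rule continuous_on_if_derivative)
  have cY: "continuous_on A Y" for A
    unfolding Y_def using deriv_coords(2) by (rule continuous_on_if_derivative)
  have cX': "continuous_on A X'" for A
    unfolding X'_def by (intro continuous_intros continuous_on_subset[OF radius(2)]) auto
  have S2: "X (2 * pi) = X 0" "Y (2 * pi) = Y 0"
    using support_pt_2pi[of 0] by (simp_all add: X_def Y_def)
  define c d where "c = X pi" and "d = X 0"
  have dec: "X t < X s" if "0 \<le> s" "s < t" "t \<le> pi" for s t
  proof (rule DERIV_neg_imp_decreasing_open[OF that(2)])
    show "\<exists>y. (X has_real_derivative y) (at x) \<and> y < 0" if "s < x" "x < t" for x
      using dX[of x] radius(1)[of x] sin_gt_zero[of x] that \<open>0 \<le> s\<close> \<open>t \<le> pi\<close>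
      by (intro exI[of _ "X' x"]) (simp add: X'_def)
  qed (rule cX)
  have inc: "X s < X t" if "pi \<le> s" "s < t" "t \<le> 2 * pi" for s t
  proof (rule DERIV_pos_imp_increasing_open[OF that(2)])
    show "\<exists>y. (X has_real_derivative y) (at x) \<and> y > 0" if "s < x" "x < t" for x
      using dX[of x] radius(1)[of x] sin_lt_zero[of x] that \<open>pi \<le> s\<close> \<open>t \<le> 2 * pi\<close>
      by (intro exI[of _ "X' x"]) (simp add: X'_def mult_pos_neg)
  qed (rule cX)
  have cd: "c < d" using dec[of 0 pi] by (simp add: c_def d_def)
  have img1: "X ` {0..pi} = {c..d}"
  proof (intro equalityI subsetI)
    fix x assume "x \<in> X ` {0..pi}"
    then obtain t where "0 \<le> t" "t \<le> pi" "x = X t" by auto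
    then show "x \<in> {c..d}" using dec[of 0 t] dec[of t pi] by (cases "t = 0"; cases "t = pi") (auto simp: c_def d_def)
  next
    fix x assume "x \<in> {c..d}"
    then show "x \<in> X ` {0..pi}" using IVT2'[of X pi x 0] cX by (force simp: c_def d_def)
  qed
  have img2: "X ` {pi..2 * pi} = {c..d}"
  proof (intro equalityI subsetI)
    fix x assume "x \<in> X ` {pi..2 * pi}"
    then obtain t where "pi \<le> t" "t \<le> 2 * pi" "x = X t" by auto
    then show "x \<in> {c..d}" using inc[of pi t] inc[of t "2 * pi"] S2
      by (cases "t = 2 * pi"; cases "t = pi") (auto simp: c_def d_def)
  next
    fix x assume "x \<in> {c..d}"
    then show "x \<in> X ` {pi..2 * pi}" using IVT'[of X pi x "2 * pi"] cX S2 by (force simp: c_def d_def)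
  qed
  have inj1: "inj_on X {0..pi}"
    by (rule linorder_inj_onI) (use dec in force)+
  have inj2: "inj_on X {pi..2 * pi}"
    by (rule linorder_inj_onI) (use inc in force)+
  obtain up where up: "continuous_on {c..d} up" "\<And>t. t \<in> {0..pi} \<Longrightarrow> up (X t) = Y t"
    and iu: "integral {0..pi} (\<lambda>t. X' t * Y t) = integral {X 0..X pi} up - integral {X pi..X 0} up"
    by (rule monotone_arc_is_graph[OF _ dX inj1 cY img1]) simp_all
  obtain lo where lo: "continuous_on {c..d} lo" "\<And>t. t \<in> {pi..2 * pi} \<Longrightarrow> lo (X t) = Y t"
    and il: "integral {pi..2 * pi} (\<lambda>t. X' t * Y t) = integral {X pi..X (2 * pi)} lo - integral {X (2 * pi)..X pi} lo"
    by (rule monotone_arc_is_graph[OF _ dX inj2 cY img2]) simp_all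
  \<comment> \<open>A vertical line strictly between the extreme abscissae meets both arcs; the support lines at the
      two points have normals pointing up and down, so they bound the slice.\<close>
  have slice: "Pair x -` K = {lo x..up x}" if "c < x" "x < d" for x
  proof -
    have x: "x \<in> {c..d}" using that by simp
    obtain s where s: "s \<in> {0..pi}" "x = X s" using x img1 by blast
    obtain t where t: "t \<in> {pi..2 * pi}" "x = X t" using x img2 by blast
    have "s \<noteq> 0" "s \<noteq> pi" "t \<noteq> pi" "t \<noteq> 2 * pi" using s t that S2 by (auto simp: c_def d_def)
    then have sin: "sin s > 0" "sin t < 0" using s(1) t(1) by (auto intro!: sin_gt_zero sin_lt_zero)
    have ux: "up x = Y s" "lo x = Y t"
      using up(2)[OF s(1)] lo(2)[OF t(1)] by (simp_all only: s(2)[symmetric] t(2)[symmetric])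
    have "y \<le> up x" if "(x, y) \<in> K" for y
      using support_pt_max[OF that, of s] sin(1)
      by (simp add: p_support_pt XY unit_vec_def s(2) ux flip: s(2))
    moreover have "lo x \<le> y" if "(x, y) \<in> K" for y
      using support_pt_max[OF that, of t] sin(2)
      by (simp add: p_support_pt XY unit_vec_def t(2) ux flip: t(2))
    moreover have "(x, y) \<in> K" if "lo x \<le> y" "y \<le> up x" for y
    proof -
      have "(x, up x) \<in> K" "(x, lo x) \<in> K"
        using support_pt_in[of s] support_pt_in[of t]
        by (simp_all only: XY ux s(2)[symmetric] t(2)[symmetric])
      then have "closed_segment (x, lo x) (x, up x) \<subseteq> K"
        using K_facts(2)[OF scd] by (simp add: closed_segment_subset)
      moreover have "(x, y) \<in> closed_segment (x, lo x) (x, up x)"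
      proof -
        have "y \<in> closed_segment (lo x) (up x)" using that by (simp add: closed_segment_eq_real_ivl)
        then obtain u where "0 \<le> u" "u \<le> 1" "y = (1 - u) *\<^sub>R lo x + u *\<^sub>R up x"
          unfolding in_segment by blast
        then show ?thesis unfolding in_segment
          by (intro exI[of _ u]) (simp add: algebra_simps)
      qed
      ultimately show ?thesis by blast
    qed
    ultimately have "(x, y) \<in> K \<longleftrightarrow> y \<in> {lo x..up x}" for y
      unfolding atLeastAtMost_iff by blast
    then show ?thesis by (intro set_eqI) (simp only: vimage_eq)
  qed
  have outside: "Pair x -` K = {}" if "x < c \<or> d < x" for x
  proof -
    have "\<not> (x, y) \<in> K" for y
    proof
      assume "(x, y) \<in> K"
      from support_pt_max[OF this, of 0] support_pt_max[OF this, of pi] that show False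
        by (auto simp: p_support_pt XY unit_vec_def c_def d_def)
    qed
    then show ?thesis by auto
  qed
  have le: "lo x \<le> up x" if x: "x \<in> {c..d}" for x
  proof (cases "c < x \<and> x < d")
    case True
    obtain s where "s \<in> {0..pi}" "x = X s" using x img1 by blast
    then have "Y s \<in> Pair x -` K" using support_pt_in[of s] by (simp add: XY)
    then show ?thesis using slice True by auto
  next
    case False
    then have "x = X 0 \<or> x = X pi" using x unfolding atLeastAtMost_iff c_def d_def by argo
    then show ?thesis using up(2)[of 0] up(2)[of pi] lo(2)[of "2 * pi"] lo(2)[of pi] S2 by auto
  qed
  define I where "I = integral {c..d} (\<lambda>x. up x - lo x)"
  have hI: "((\<lambda>x. up x - lo x) has_integral I) {c..d}"
    unfolding I_def by (intro integrable_integral integrable_continuous_real continuous_intros up lo)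
  have I0: "I \<ge> 0" unfolding I_def by (rule integral_nonneg) (use hI le in auto)
  have Kb: "K \<in> sets borel" using K_facts(5)[OF scd] by simp
  have "emeasure lborel K = emeasure (lborel \<Otimes>\<^sub>M lborel) K" by (simp add: lborel_prod)
  also have "\<dots> = (\<integral>\<^sup>+ x. emeasure lborel (Pair x -` K) \<partial>lborel)"
    by (rule lborel.emeasure_pair_measure_alt) (use Kb in \<open>simp only: lborel_prod sets_lborel\<close>)
  also have "\<dots> = (\<integral>\<^sup>+ x. ennreal (up x - lo x) * indicator {c..d} x \<partial>lborel)"
  proof (rule nn_integral_cong_AE)
    have "AE x in lborel. x \<noteq> c \<and> x \<noteq> d"
      using AE_lborel_singleton[of c] AE_lborel_singleton[of d] by eventually_elim simp
    then show "AE x in lborel. emeasure lborel (Pair x -` K) = ennreal (up x - lo x) * indicator {c..d} x"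
    proof eventually_elim
      case (elim x)
      consider "x < c \<or> d < x" | "c < x" "x < d" using elim by fastforce
      then show ?case by cases (use outside slice le[of x] in \<open>auto simp: indicator_def\<close>)
    qed
  qed
  also have "\<dots> = ennreal I"
    by (rule nn_integral_has_integral_lebesgue'[OF _ hI]) (use le in auto)
  finally have "measure lborel K = I" using I0 by (simp add: measure_def)
  then have "measure lebesgue K = I" using Kb by simp
  also have "I = integral {c..d} up - integral {c..d} lo"
    unfolding I_def by (intro integral_diff integrable_continuous_real up lo)
  also have "\<dots> = - (integral {0..pi} (\<lambda>t. X' t * Y t) + integral {pi..2 * pi} (\<lambda>t. X' t * Y t))"
    unfolding iu il S2 using cd by (simp add: c_def d_def)
  also have "\<dots> = - integral {0..2 * pi} (\<lambda>t. X' t * Y t)"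
    by (subst Henstock_Kurzweil_Integration.integral_combine)
       (auto intro!: integrable_continuous_real continuous_intros cX' cY)
  finally show ?thesis by (simp add: X'_def Y_def)
qed

text \<open>
  The integrand of the contour integral and half of \<open>p\<^sup>2 - p'\<^sup>2\<close> differ by the derivative of a
  periodic function.
\<close>

lemma area_eq: "measure lebesgue K = integral {0..2 * pi} (\<lambda>\<theta>. (p \<theta>)\<^sup>2 - (p' \<theta>)\<^sup>2) / 2"
proof -
  let ?X = "\<lambda>\<theta>. fst (support_pt K \<theta>)" and ?Y = "\<lambda>\<theta>. snd (support_pt K \<theta>)"
  let ?F = "\<lambda>\<theta>. (p \<theta> * p' \<theta> - ?X \<theta> * ?Y \<theta>) / 2"
  have cS: "continuous_on A ?Y" for A using deriv_coords(2) by (rule continuous_on_if_derivative)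
  have cr: "continuous_on A radius" for A using continuous_on_subset[OF radius(2)] by blast
  have dF: "(?F has_real_derivative radius \<theta> * sin \<theta> * ?Y \<theta> - ((p \<theta>)\<^sup>2 - (p' \<theta>)\<^sup>2) / 2) (at \<theta>)" for \<theta>
  proof -
    have "p \<theta> * radius \<theta> = radius \<theta> * (?X \<theta> * cos \<theta> + ?Y \<theta> * sin \<theta>)"
      by (simp add: p_support_pt unit_vec_def inner_prod_def)
    then show ?thesis
      by (auto intro!: derivative_eq_intros deriv_coords deriv_p deriv_p' simp: algebra_simps power2_eq_square add_divide_distrib diff_divide_distrib)
  qed
  have per: "?F (2 * pi) = ?F 0"
    using support_pt_2pi[of 0] p.periodic[of 0] p.periodic'[of 0] by simp
  have "0 = integral {0..2 * pi} (\<lambda>\<theta>. radius \<theta> * sin \<theta> * ?Y \<theta> - ((p \<theta>)\<^sup>2 - (p' \<theta>)\<^sup>2) / 2)"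
    using has_integral_periodic_derivative[OF dF per] by (simp add: integral_unique)
  also have "\<dots> = integral {0..2 * pi} (\<lambda>\<theta>. radius \<theta> * sin \<theta> * ?Y \<theta>) - integral {0..2 * pi} (\<lambda>\<theta>. ((p \<theta>)\<^sup>2 - (p' \<theta>)\<^sup>2) / 2)"
    by (intro integral_diff integrable_continuous_real continuous_intros cS cr p.cont p.cont'_on) auto
  finally show ?thesis unfolding area_contour by simp
qed

text \<open>
  A support point of the symmetral is composed of the support points of the body in the two
  opposite directions.
\<close>

lemma steiner_symmetral_supp_fun:
  "supp_fun (frontier (steiner_symmetral K)) \<theta> = steiner_point K \<bullet> unit_vec \<theta> + (p \<theta> + p (\<theta> + pi)) / 2"
proof -
  let ?s = "steiner_point K"
  let ?z = "?s + (1/2) *\<^sub>R (support_pt K \<theta> + - support_pt K (\<theta> + pi))"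
  have eq: "steiner_symmetral K = (\<lambda>z. ?s + (1/2) *\<^sub>R (fst z + - snd z)) ` (K \<times> K)" (is "_ = ?f ` _")
  proof (intro equalityI subsetI)
    fix w assume "w \<in> steiner_symmetral K"
    then obtain x y where "x \<in> K" "y \<in> K" "w = ?s + (1/2) *\<^sub>R (x + - y)"
      unfolding steiner_symmetral_def by blast
    then show "w \<in> ?f ` (K \<times> K)" by (intro image_eqI[of _ _ "(x, y)"]) simp_all
  next
    fix w assume "w \<in> ?f ` (K \<times> K)"
    then obtain z where "z \<in> K \<times> K" "w = ?f z" by blast
    then show "w \<in> steiner_symmetral K" unfolding steiner_symmetral_def mem_Times_iff by blast
  qed
  have "compact (steiner_symmetral K)" unfolding eq
    by (intro compact_continuous_image compact_Times K_facts(1)[OF scd] continuous_intros)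
  moreover have "?z \<in> steiner_symmetral K"
    using support_pt_in unfolding steiner_symmetral_def by blast
  moreover have "w \<bullet> unit_vec \<theta> \<le> ?s \<bullet> unit_vec \<theta> + (p \<theta> + p (\<theta> + pi)) / 2" if w: "w \<in> steiner_symmetral K" for w
  proof -
    obtain x y where xy: "x \<in> K" "y \<in> K" "w = ?s + (1/2) *\<^sub>R (x + - y)"
      using w unfolding steiner_symmetral_def by blast
    show ?thesis
      using support_pt_max[OF xy(1), of \<theta>] support_pt_max[OF xy(2), of "\<theta> + pi"]
      by (simp add: xy(3) inner_add_left inner_diff_left unit_vec_minus)
  qed
  moreover have "?z \<bullet> unit_vec \<theta> = ?s \<bullet> unit_vec \<theta> + (p \<theta> + p (\<theta> + pi)) / 2"
    by (simp add: inner_add_left inner_diff_left unit_vec_minus p_support_pt)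
  ultimately show ?thesis using supp_fun_frontier_eq[of "steiner_symmetral K" ?z \<theta>] by metis
qed

text \<open>
  The traversal is that of the boundary of the Minkowski sum of the body and its reflection, moved
  inwards by \<open>curve_length \<gamma> / pi\<close>.  Hence it has the formal support function \<open>w\<close>, and the formula for the
  area in terms of the support function carries over to oriented areas.
\<close>

lemma CWMS_area_eq:
  fixes w w'
  defines "w \<equiv> \<lambda>\<theta>. p \<theta> + p (\<theta> + pi) - curve_length \<gamma> / pi" and "w' \<equiv> \<lambda>\<theta>. p' \<theta> + p' (\<theta> + pi)"
  shows "CWMS_area \<gamma> = integral {0..2 * pi} (\<lambda>\<theta>. (w \<theta>)\<^sup>2 - (w' \<theta>)\<^sup>2) / 2"
proof -
  define m where "m \<theta> = radius \<theta> + radius (\<theta> + pi) - curve_length \<gamma> / pi" for \<theta>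
  let ?c = "CWMS_param \<gamma>"
  have c: "?c = (\<lambda>\<theta>. support_pt K \<theta> - support_pt K (\<theta> + pi) + (curve_length \<gamma> / pi) *\<^sub>R - unit_vec \<theta>)"
    by (simp add: CWMS_param_def[abs_def] supp_param_support_pt[OF scd] flip: fr)
  have rp: "rot90 (unit_vec (\<theta> + pi)) = - rot90 (unit_vec \<theta>)" for \<theta>
    by (simp add: rot90_def unit_vec_def)
  have S': "((\<lambda>\<theta>. support_pt K (\<theta> + pi)) has_vector_derivative radius (\<theta> + pi) *\<^sub>R - rot90 (unit_vec \<theta>)) (at \<theta>)" for \<theta>
  proof -
    have "((\<lambda>\<theta>::real. \<theta> + pi) has_real_derivative 1) (at \<theta>)" by (auto intro!: derivative_eq_intros)
    then show ?thesis
      using vector_diff_chain_at[OF _ radius(3), of "\<lambda>\<theta>. \<theta> + pi" 1 \<theta>]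
      by (simp add: o_def has_real_derivative_iff_has_vector_derivative rp)
  qed
  have "(?c has_vector_derivative radius \<theta> *\<^sub>R rot90 (unit_vec \<theta>) - radius (\<theta> + pi) *\<^sub>R - rot90 (unit_vec \<theta>)
      + (curve_length \<gamma> / pi) *\<^sub>R - rot90 (unit_vec \<theta>)) (at \<theta>)" for \<theta>
    unfolding c
    by (intro has_vector_derivative_add has_vector_derivative_diff has_vector_derivative_minus radius(3) S'
        bounded_linear.has_vector_derivative[OF bounded_linear_scaleR_right] has_vector_derivative_unit_vec)
  then have vc: "vderiv ?c \<theta> = m \<theta> *\<^sub>R rot90 (unit_vec \<theta>)" for \<theta>
    unfolding vderiv_def m_def by (subst vector_derivative_at) (auto simp: algebra_simps)
  have cu: "?c \<theta> \<bullet> unit_vec \<theta> = w \<theta>" for \<theta>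
    unfolding c by (simp add: w_def inner_add_left inner_diff_left p_support_pt unit_vec_minus)
  have int: "- snd (?c \<theta>) * fst (vderiv ?c \<theta>) + fst (?c \<theta>) * snd (vderiv ?c \<theta>) = m \<theta> * w \<theta>" for \<theta>
    unfolding cu[symmetric] vc by (simp add: rot90_def unit_vec_def inner_prod_def algebra_simps)
  have sp: "continuous_on A (\<lambda>\<theta>. f (\<theta> + pi))" if "continuous_on UNIV f" for f :: "real \<Rightarrow> real" and A
    by (rule continuous_on_compose2[OF that]) (auto intro!: continuous_intros)
  note cont = sp[OF p.cont] sp[OF p.cont'] sp[OF radius(2)] p.cont p.cont'_on continuous_on_subset[OF radius(2)]
  have sh: "((\<lambda>\<theta>. p (\<theta> + pi)) has_real_derivative p' (\<theta> + pi)) (at \<theta>)"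
    "((\<lambda>\<theta>. p' (\<theta> + pi)) has_real_derivative radius (\<theta> + pi) - p (\<theta> + pi)) (at \<theta>)" for \<theta>
    using deriv_p[of "\<theta> + pi"] deriv_p'[of "\<theta> + pi"] unfolding DERIV_shift by auto
  have d: "((\<lambda>\<theta>. w \<theta> * w' \<theta>) has_real_derivative m \<theta> * w \<theta> - ((w \<theta>)\<^sup>2 - (w' \<theta>)\<^sup>2)) (at \<theta>)" for \<theta>
    unfolding w_def w'_def m_def
    by (rule derivative_eq_intros deriv_p deriv_p' sh refl)+ (simp add: algebra_simps power2_eq_square)
  have per: "w (2 * pi) * w' (2 * pi) = w 0 * w' 0"
    using p.periodic[of 0] p.periodic'[of 0] p.periodic[of pi] p.periodic'[of pi]
    by (simp add: w_def w'_def add.commute)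
  have "0 = integral {0..2 * pi} (\<lambda>\<theta>. m \<theta> * w \<theta> - ((w \<theta>)\<^sup>2 - (w' \<theta>)\<^sup>2))"
    using has_integral_periodic_derivative[OF d per] by (simp add: integral_unique)
  also have "\<dots> = integral {0..2 * pi} (\<lambda>\<theta>. m \<theta> * w \<theta>) - integral {0..2 * pi} (\<lambda>\<theta>. (w \<theta>)\<^sup>2 - (w' \<theta>)\<^sup>2)"
    unfolding w_def w'_def m_def
    by (intro integral_diff integrable_continuous_real continuous_intros cont) auto
  finally show ?thesis unfolding CWMS_area_def oriented_area_def int by simp
qed

end


section \<open>Splitting off the even and the odd harmonics\<close>

lemma integral_antiperiodic:
  fixes f :: "real \<Rightarrow> real"
  assumes cont: "continuous_on UNIV f" and anti: "\<And>t. f (t + pi) = - f t"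
  shows "integral {0..2 * pi} f = 0"
proof -
  have "f (t + 2 * pi) = f t" for t
    using anti[of "t + pi"] anti[of t] by (simp add: add.assoc)
  then have "integral {0..2 * pi} (\<lambda>t. f (t + pi)) = integral {0..2 * pi} f"
    by (rule integral_periodic_shift[OF cont])
  then show ?thesis by (simp add: anti)
qed

lemma integral_half_turn:
  assumes "periodic_C1 f f'"
  shows "integral {0..2 * pi} (\<lambda>t. f (t + pi)) = integral {0..2 * pi} f"
  using integral_periodic_shift[OF periodic_C1.cont[OF assms] periodic_C1.periodic[OF assms]] .

lemma trig_half_turn:
  "cos (real n * (t + pi)) = (if even n then cos (real n * t) else - cos (real n * t))"
  "sin (real n * (t + pi)) = (if even n then sin (real n * t) else - sin (real n * t))"
  by (simp_all add: distrib_left cos_add sin_add)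

lemma antiperiodic_coeff:
  assumes "continuous_on UNIV f" "\<And>t. f (t + pi) = - f t" "even n"
  shows "fourier_cos f n = 0" "fourier_sin f n = 0"
  unfolding fourier_cos_def fourier_sin_def using assms
  by (simp_all add: integral_antiperiodic continuous_intros trig_half_turn)

lemma half_periodic_coeff:
  assumes "continuous_on UNIV f" "\<And>t. f (t + pi) = f t" "odd n"
  shows "fourier_cos f n = 0" "fourier_sin f n = 0"
  unfolding fourier_cos_def fourier_sin_def using assms
  by (simp_all add: integral_antiperiodic continuous_intros trig_half_turn)

context oval_domain
begin

text \<open>
  The support function is split into the mean \<open>a0\<close>, the remaining even harmonics \<open>g\<close>, the first
  harmonic \<open>e\<close> (the support function of the Steiner point) and the odd harmonics \<open>h\<close> of order at
  least three.  The last one is also the difference of the support functions of the body and of its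
  Steiner symmetral.
\<close>

definition a0 :: real where "a0 = curve_length \<gamma> / (2 * pi)"
definition s1 :: real where "s1 = fst (steiner_point K)"
definition s2 :: real where "s2 = snd (steiner_point K)"

definition g :: "real \<Rightarrow> real" where "g t = (p t + p (t + pi)) / 2 - a0"
definition g' :: "real \<Rightarrow> real" where "g' t = (p' t + p' (t + pi)) / 2"
definition e :: "real \<Rightarrow> real" where "e t = s1 * cos t + s2 * sin t"
definition e' :: "real \<Rightarrow> real" where "e' t = s2 * cos t - s1 * sin t"
definition h :: "real \<Rightarrow> real" where "h t = (p t - p (t + pi)) / 2 - e t"
definition h' :: "real \<Rightarrow> real" where "h' t = (p' t - p' (t + pi)) / 2 - e' t"

lemma deriv_p_shift: "((\<lambda>t. p (t + pi)) has_real_derivative p' (t + pi)) (at t)"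
  using deriv_p[of "t + pi"] unfolding DERIV_shift .

lemma p_half_turn: "p (t + pi + pi) = p t" "p' (t + pi + pi) = p' t"
proof -
  have eq: "t + pi + pi = t + 2 * pi" by simp
  show "p (t + pi + pi) = p t" "p' (t + pi + pi) = p' t"
    unfolding eq by (rule p.periodic p.periodic')+
qed

lemma cont_p'_shift: "continuous_on A (\<lambda>t. p' (t + pi))"
  by (rule continuous_on_compose2[OF p.cont']) (auto intro!: continuous_intros)

lemma cont_p_shift: "continuous_on A (\<lambda>t. p (t + pi))"
  by (rule continuous_on_compose2[OF p.cont[of UNIV]]) (auto intro!: continuous_intros)

lemma g_half_turn: "g (t + pi) = g t" "g' (t + pi) = g' t"
  unfolding g_def g'_def p_half_turn by simp_all

lemma e_half_turn: "e (t + pi) = - e t" "e' (t + pi) = - e' t"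
  by (simp_all add: e_def e'_def)

lemma h_half_turn: "h (t + pi) = - h t" "h' (t + pi) = - h' t"
  unfolding h_def h'_def p_half_turn e_half_turn by (simp_all add: field_simps)

lemma deriv_e: "(e has_real_derivative e' t) (at t)" "(e' has_real_derivative - e t) (at t)"
  unfolding e_def[abs_def] e'_def[abs_def] by (auto intro!: derivative_eq_intros)

lemma cont_e: "continuous_on A e" "continuous_on A e'"
  by (rule continuous_on_if_derivative, rule deriv_e)+

sublocale g: periodic_C1 g g'
proof
  show "(g has_real_derivative g' t) (at t)" for t
    unfolding g_def[abs_def] g'_def
    by (auto intro!: derivative_eq_intros deriv_p deriv_p_shift)
  show "continuous_on UNIV g'"
    unfolding g'_def[abs_def] by (intro continuous_intros p.cont' cont_p'_shift) auto
  show "g (t + 2 * pi) = g t" for t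
  proof -
    have eq: "t + 2 * pi = t + pi + pi" by simp
    show ?thesis unfolding eq g_half_turn ..
  qed
qed

sublocale h: periodic_C1 h h'
proof
  show "(h has_real_derivative h' t) (at t)" for t
    unfolding h_def[abs_def] h'_def
    by (auto intro!: derivative_eq_intros deriv_p deriv_p_shift deriv_e)
  show "continuous_on UNIV h'"
    unfolding h'_def[abs_def] by (intro continuous_intros p.cont' cont_p'_shift cont_e) auto
  show "h (t + 2 * pi) = h t" for t
  proof -
    have eq: "t + 2 * pi = t + pi + pi" by simp
    show ?thesis unfolding eq h_half_turn by simp
  qed
qed

lemma p_decomp: "p t = a0 + g t + h t + e t" "p' t = g' t + h' t + e' t"
  by (simp_all add: g_def h_def g'_def h'_def field_simps)

lemma mean_g: "integral {0..2 * pi} g = 0"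
proof -
  have "integral {0..2 * pi} (\<lambda>t. p (t + pi)) = integral {0..2 * pi} p"
    using integral_half_turn[OF p.periodic_C1_axioms] .
  moreover have "integral {0..2 * pi} g = integral {0..2 * pi} (\<lambda>t. p t / 2 + p (t + pi) / 2 - a0)"
    by (simp add: g_def[abs_def] add_divide_distrib)
  moreover have "\<dots> = integral {0..2 * pi} (\<lambda>t. p t / 2 + p (t + pi) / 2) - integral {0..2 * pi} (\<lambda>t. a0)"
    by (intro integral_diff integrable_continuous_real continuous_intros p.cont cont_p_shift) auto
  moreover have "integral {0..2 * pi} (\<lambda>t. p t / 2 + p (t + pi) / 2) =
      integral {0..2 * pi} (\<lambda>t. p t / 2) + integral {0..2 * pi} (\<lambda>t. p (t + pi) / 2)"
    by (intro integral_add integrable_continuous_real continuous_intros p.cont cont_p_shift) auto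
  ultimately show ?thesis using curve_length_eq by (simp add: a0_def)
qed

lemma steiner_coeff: "s1 = fourier_cos p 1" "s2 = fourier_sin p 1"
proof -
  have i: "(\<lambda>\<theta>. p \<theta> *\<^sub>R unit_vec \<theta>) integrable_on {0..2 * pi}"
    unfolding unit_vec_def by (intro integrable_continuous_real continuous_intros p.cont)
  have "fst (integral {0..2 * pi} (\<lambda>\<theta>. p \<theta> *\<^sub>R unit_vec \<theta>)) = integral {0..2 * pi} (\<lambda>\<theta>. p \<theta> * cos \<theta>)"
    using integral_linear[OF i bounded_linear_fst] by (simp add: o_def unit_vec_def)
  then show "s1 = fourier_cos p 1"
    by (simp add: s1_def steiner_point_def fourier_cos_def flip: p_def)
  have "snd (integral {0..2 * pi} (\<lambda>\<theta>. p \<theta> *\<^sub>R unit_vec \<theta>)) = integral {0..2 * pi} (\<lambda>\<theta>. p \<theta> * sin \<theta>)"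
    using integral_linear[OF i bounded_linear_snd] by (simp add: o_def unit_vec_def)
  then show "s2 = fourier_sin p 1"
    by (simp add: s2_def steiner_point_def fourier_sin_def flip: p_def)
qed

lemma h_coeff_1: "fourier_cos h 1 = 0" "fourier_sin h 1 = 0"
proof -
  have h: "h t = p t - (a0 + g t) - e t" for t using p_decomp(1)[of t] by simp
  have z: "integral {0..2 * pi} (\<lambda>t. (a0 + g t) * cos t) = 0" "integral {0..2 * pi} (\<lambda>t. (a0 + g t) * sin t) = 0"
    by (intro integral_antiperiodic continuous_intros g.cont; simp add: g_half_turn)+
  have ee: "((\<lambda>t. e t * cos t) has_integral (s1 * pi)) {0..2 * pi}" "((\<lambda>t. e t * sin t) has_integral (s2 * pi)) {0..2 * pi}"
    using has_integral_add[OF has_integral_mult_right[OF has_integral_trig_products(1)[of 1 1], of s1]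
       has_integral_mult_right[OF has_integral_trig_products(3)[of 1 1], of s2]]
      has_integral_add[OF has_integral_mult_right[OF has_integral_trig_products(4)[of 1 1], of s1]
       has_integral_mult_right[OF has_integral_trig_products(2)[of 1 1], of s2]]
    by (simp_all add: e_def algebra_simps)
  have "integral {0..2 * pi} (\<lambda>t. h t * cos t) = integral {0..2 * pi} (\<lambda>t. p t * cos t - (a0 + g t) * cos t - e t * cos t)"
    by (simp add: h algebra_simps)
  also have "\<dots> = integral {0..2 * pi} (\<lambda>t. p t * cos t - (a0 + g t) * cos t) - integral {0..2 * pi} (\<lambda>t. e t * cos t)"
    by (intro integral_diff integrable_continuous_real continuous_intros p.cont g.cont cont_e)
  also have "integral {0..2 * pi} (\<lambda>t. p t * cos t - (a0 + g t) * cos t) = integral {0..2 * pi} (\<lambda>t. p t * cos t) - integral {0..2 * pi} (\<lambda>t. (a0 + g t) * cos t)"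
    by (intro integral_diff integrable_continuous_real continuous_intros p.cont g.cont cont_e)
  finally show "fourier_cos h 1 = 0"
    using z ee steiner_coeff by (simp add: fourier_cos_def integral_unique)
  have "integral {0..2 * pi} (\<lambda>t. h t * sin t) = integral {0..2 * pi} (\<lambda>t. p t * sin t - (a0 + g t) * sin t - e t * sin t)"
    by (simp add: h algebra_simps)
  also have "\<dots> = integral {0..2 * pi} (\<lambda>t. p t * sin t - (a0 + g t) * sin t) - integral {0..2 * pi} (\<lambda>t. e t * sin t)"
    by (intro integral_diff integrable_continuous_real continuous_intros p.cont g.cont cont_e)
  also have "integral {0..2 * pi} (\<lambda>t. p t * sin t - (a0 + g t) * sin t) = integral {0..2 * pi} (\<lambda>t. p t * sin t) - integral {0..2 * pi} (\<lambda>t. (a0 + g t) * sin t)"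
    by (intro integral_diff integrable_continuous_real continuous_intros p.cont g.cont cont_e)
  finally show "fourier_sin h 1 = 0"
    using z ee steiner_coeff by (simp add: fourier_sin_def integral_unique)
qed

lemma h_low: "fourier_cos h 0 = 0" "0 < n \<Longrightarrow> n < 3 \<Longrightarrow> energy h n = 0"
proof -
  note even = antiperiodic_coeff[OF h.cont h_half_turn(1)]
  show "fourier_cos h 0 = 0" by (rule even) simp
  assume "0 < n" "n < 3"
  then consider "n = 1" | "n = 2" by linarith
  then show "energy h n = 0"
    by cases (use h_coeff_1 even[of 2] in \<open>simp_all add: energy_def\<close>)
qed

text \<open>
  The three integrals to which all quantities of the theorem reduce.
\<close>

definition Gi :: real where "Gi = integral {0..2 * pi} (\<lambda>t. (g t)\<^sup>2 - (g' t)\<^sup>2)"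
definition H0 :: real where "H0 = integral {0..2 * pi} (\<lambda>t. (h t)\<^sup>2)"
definition H1 :: real where "H1 = integral {0..2 * pi} (\<lambda>t. (h' t)\<^sup>2)"

text \<open>
  Wirtinger's inequality for the mean-free function \<open>g\<close>: the oriented area of the Constant Width
  Measure Set is never positive, so its absolute value is its negative.
\<close>

lemma Gi_nonpos: "Gi \<le> 0"
proof -
  have "integral {0..2 * pi} (\<lambda>t. (g t)\<^sup>2) \<le> integral {0..2 * pi} (\<lambda>t. (g' t)\<^sup>2)"
    using g.wirtinger(1)[of 1] mean_g by (simp add: fourier_cos_def)
  moreover have "Gi = integral {0..2 * pi} (\<lambda>t. (g t)\<^sup>2) - integral {0..2 * pi} (\<lambda>t. (g' t)\<^sup>2)"
    unfolding Gi_def by (intro integral_diff integrable_continuous_real continuous_intros g.cont g.cont'_on)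
  ultimately show ?thesis by simp
qed

lemma CWMS_area_Gi: "CWMS_area \<gamma> = 2 * Gi"
proof -
  have "p t + p (t + pi) - curve_length \<gamma> / pi = 2 * g t" "p' t + p' (t + pi) = 2 * g' t" for t
    by (simp_all add: g_def g'_def a0_def field_simps)
  then have "CWMS_area \<gamma> = integral {0..2 * pi} (\<lambda>t. 4 * ((g t)\<^sup>2 - (g' t)\<^sup>2)) / 2"
    unfolding CWMS_area_eq by (simp add: power_mult_distrib right_diff_distrib)
  then show ?thesis unfolding integral_mult_right Gi_def by simp
qed

lemma d2_H0: "(d2 K (steiner_symmetral K))\<^sup>2 = H0"
proof -
  have "supp_fun (frontier K) t - supp_fun (frontier (steiner_symmetral K)) t = h t" for t
    unfolding steiner_symmetral_supp_fun h_def e_def s1_def s2_def p_def[symmetric]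
    by (simp add: unit_vec_def inner_prod_def field_simps)
  moreover have "H0 \<ge> 0"
    unfolding H0_def by (intro integral_nonneg integrable_continuous_real continuous_intros h.cont) simp
  ultimately show ?thesis by (simp add: d2_def H0_def)
qed

text \<open>
  The summands of \<open>p\<close> do not interact.  Products of an even and an odd part change sign under a
  half turn and integrate to zero, the mixed terms of the mean vanish because \<open>g\<close> has mean zero, and
  everything quadratic that involves \<open>e\<close> is the derivative of a periodic function, since
  \<open>e'' = - e\<close>.
\<close>

lemma area_split: "integral {0..2 * pi} (\<lambda>t. (p t)\<^sup>2 - (p' t)\<^sup>2) = 2 * pi * a0\<^sup>2 + Gi + (H0 - H1)"
proof -
  define odd where "odd t = 2 * ((a0 + g t) * (h t + e t) - g' t * (h' t + e' t))" for t
  define exact where "exact t = 2 * (h t * e t - h' t * e' t) + ((e t)\<^sup>2 - (e' t)\<^sup>2)" for t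
  note cont = g.cont g.cont'_on h.cont h.cont'_on cont_e
  have oddi: "(odd has_integral 0) {0..2 * pi}"
  proof -
    have "continuous_on UNIV odd"
      unfolding odd_def[abs_def] by (intro continuous_intros cont)
    moreover have "odd (t + pi) = - odd t" for t
      unfolding odd_def g_half_turn h_half_turn e_half_turn by (simp add: algebra_simps)
    ultimately show ?thesis
      using integral_antiperiodic integrable_continuous_real continuous_on_subset
      by (metis has_integral_iff top_greatest)
  qed
  have exacti: "(exact has_integral 0) {0..2 * pi}"
  proof (rule has_integral_periodic_derivative)
    show "((\<lambda>t. - (2 * (h t * e' t) + e t * e' t)) has_real_derivative exact t) (at t)" for t
      unfolding exact_def
      by (rule derivative_eq_intros h.deriv deriv_e refl)+ (simp add: algebra_simps power2_eq_square)
    show "- (2 * (h (2 * pi) * e' (2 * pi)) + e (2 * pi) * e' (2 * pi)) = - (2 * (h 0 * e' 0) + e 0 * e' 0)"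
      using h.periodic[of 0] by (simp add: e_def e'_def)
  qed
  have i: "(\<lambda>t. (g t)\<^sup>2 - (g' t)\<^sup>2) integrable_on {0..2 * pi}" "(\<lambda>t. (h t)\<^sup>2) integrable_on {0..2 * pi}"
    "(\<lambda>t. (h' t)\<^sup>2) integrable_on {0..2 * pi}" "g integrable_on {0..2 * pi}"
    by (intro integrable_continuous_real continuous_intros cont)+
  have gi: "(g has_integral 0) {0..2 * pi}" using mean_g i(4) by (simp add: has_integral_iff)
  have c0: "((\<lambda>t. a0\<^sup>2) has_integral (2 * pi * a0\<^sup>2)) {0..2 * pi}"
    using has_integral_const_real[of "a0\<^sup>2" 0 "2 * pi"] by simp
  have "((\<lambda>t. a0\<^sup>2 + ((g t)\<^sup>2 - (g' t)\<^sup>2) + ((h t)\<^sup>2 - (h' t)\<^sup>2) + 2 * a0 * g t + odd t + exact t)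
    has_integral (2 * pi * a0\<^sup>2 + Gi + (H0 - H1) + 2 * a0 * 0 + 0 + 0)) {0..2 * pi}"
    unfolding Gi_def H0_def H1_def
    by (intro has_integral_add has_integral_diff has_integral_mult_right c0 gi oddi exacti integrable_integral i)
  moreover have "a0\<^sup>2 + ((g t)\<^sup>2 - (g' t)\<^sup>2) + ((h t)\<^sup>2 - (h' t)\<^sup>2) + 2 * a0 * g t + odd t + exact t = (p t)\<^sup>2 - (p' t)\<^sup>2" for t
    unfolding p_decomp odd_def exact_def by (simp add: algebra_simps power2_eq_square)
  ultimately show ?thesis by (simp add: integral_unique)
qed

text \<open>
  The absolute value of the oriented area cancels the contribution of the even harmonics to the
  isoperimetric deficit.
\<close>

lemma deficit_eq:
  "(curve_length \<gamma>)\<^sup>2 - 4 * pi * measure lebesgue K - pi * \<bar>CWMS_area \<gamma>\<bar> = 2 * pi * (H1 - H0)"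
proof -
  have L: "curve_length \<gamma> = 2 * pi * a0" by (simp add: a0_def)
  have C: "\<bar>CWMS_area \<gamma>\<bar> = - 2 * Gi" using Gi_nonpos by (simp add: CWMS_area_Gi)
  show ?thesis unfolding L C area_eq area_split
    by (simp add: algebra_simps power2_eq_square add_divide_distrib diff_divide_distrib)
qed

lemma third_harmonic_wirtinger:
  "9 * H0 \<le> H1" "9 * H0 = H1 \<Longrightarrow> h = harmonic h 3"
proof -
  show "9 * H0 \<le> H1"
    unfolding H0_def H1_def using h.wirtinger(1)[of 3] h_low by simp
  assume "9 * H0 = H1"
  then show "h = harmonic h 3"
    unfolding H0_def H1_def using h.wirtinger(2)[of 3] h_low by simp
qed

text \<open>
  The coefficients of order one of \<open>h\<close> vanish, so only the third harmonic survives in \<open>h\<close>; then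
  \<open>h'' = - 9 * h\<close>, and \<open>h'\<^sup>2 - 9 * h\<^sup>2\<close> is the derivative of the periodic function \<open>h * h'\<close>.
\<close>

lemma equality_if_odd_part:
  assumes odd: "\<And>t. p t - p (t + pi) = 2 * (a1 * cos t + b1 * sin t + a3 * cos (3 * t) + b3 * sin (3 * t))"
  shows "9 * H0 = H1"
proof -
  define c d where "c = a1 - s1" and "d = b1 - s2"
  have h: "h t = c * cos (real 1 * t) + d * sin (real 1 * t) + a3 * cos (real 3 * t) + b3 * sin (real 3 * t)" for t
    unfolding h_def odd e_def c_def d_def by (simp add: algebra_simps)
  have "((\<lambda>t. c * (cos (real 1 * t) * cos (real 1 * t)) + d * (sin (real 1 * t) * cos (real 1 * t))
      + a3 * (cos (real 3 * t) * cos (real 1 * t)) + b3 * (sin (real 3 * t) * cos (real 1 * t)))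
      has_integral (c * (if (1::nat) = 1 then pi else 0) + d * 0 + a3 * (if (3::nat) = 1 then pi else 0) + b3 * 0)) {0..2 * pi}"
    by (intro has_integral_add has_integral_mult_right has_integral_trig_products) simp_all
  then have "integral {0..2 * pi} (\<lambda>t. h t * cos (real 1 * t)) = c * pi"
    unfolding h by (simp add: integral_unique algebra_simps)
  then have c: "c = 0" using h_coeff_1(1) by (simp add: fourier_cos_def)
  have "((\<lambda>t. c * (cos (real 1 * t) * sin (real 1 * t)) + d * (sin (real 1 * t) * sin (real 1 * t))
      + a3 * (cos (real 3 * t) * sin (real 1 * t)) + b3 * (sin (real 3 * t) * sin (real 1 * t)))
      has_integral (c * 0 + d * (if (1::nat) = 1 then pi else 0) + a3 * 0 + b3 * (if (3::nat) = 1 then pi else 0))) {0..2 * pi}"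
    by (intro has_integral_add has_integral_mult_right has_integral_trig_products) simp_all
  then have "integral {0..2 * pi} (\<lambda>t. h t * sin (real 1 * t)) = d * pi"
    unfolding h by (simp add: integral_unique algebra_simps)
  then have d: "d = 0" using h_coeff_1(2) by (simp add: fourier_sin_def)
  have h3: "h t = a3 * cos (3 * t) + b3 * sin (3 * t)" for t
    using h[of t] by (simp add: c d)
  have "(h has_real_derivative 3 * (b3 * cos (3 * t) - a3 * sin (3 * t))) (at t)" for t
    unfolding h3[abs_def] by (auto intro!: derivative_eq_intros simp: algebra_simps)
  then have h'3: "h' t = 3 * (b3 * cos (3 * t) - a3 * sin (3 * t))" for t
    using h.deriv DERIV_unique by blast
  have "((\<lambda>t. (h' t)\<^sup>2 - 9 * (h t)\<^sup>2) has_integral 0) {0..2 * pi}"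
  proof (rule has_integral_periodic_derivative)
    have d': "(h' has_real_derivative - 9 * h t) (at t)" for t
      unfolding h'3[abs_def] h3 by (auto intro!: derivative_eq_intros simp: algebra_simps)
    show "((\<lambda>t. h t * h' t) has_real_derivative (h' t)\<^sup>2 - 9 * (h t)\<^sup>2) (at t)" for t
      by (rule derivative_eq_intros h.deriv d' refl)+ (simp add: power2_eq_square)
    show "h (2 * pi) * h' (2 * pi) = h 0 * h' 0"
      using h.periodic[of 0] h.periodic'[of 0] by simp
  qed
  moreover have "integral {0..2 * pi} (\<lambda>t. (h' t)\<^sup>2 - 9 * (h t)\<^sup>2) =
      integral {0..2 * pi} (\<lambda>t. (h' t)\<^sup>2) - integral {0..2 * pi} (\<lambda>t. 9 * (h t)\<^sup>2)"
    by (intro integral_diff integrable_continuous_real continuous_intros h.cont h.cont'_on)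
  ultimately show ?thesis by (simp add: H0_def H1_def integral_unique)
qed

text \<open>
  Reflection in \<open>c\<close> exchanges opposite support points, so the odd part of the support function is
  that of the single point \<open>c\<close>.
\<close>

lemma equality_if_centrally_symmetric:
  assumes "centrally_symmetric (frontier K)"
  shows "9 * H0 = H1"
proof -
  obtain c where c: "(\<lambda>x. 2 *\<^sub>R c - x) ` frontier K = frontier K"
    using assms unfolding centrally_symmetric_def by blast
  have fr_in: "support_pt K t \<in> frontier K" for t
    using is_support_pt_frontier[OF scd support_pt[OF scd]] .
  have "p t - p (t + pi) = 2 * (c \<bullet> unit_vec t)" for t
  proof (rule antisym)
    obtain y where y: "y \<in> frontier K" "support_pt K t = 2 *\<^sub>R c - y"
      using fr_in[of t] c by (metis imageE)
    have "y \<in> K" using y(1) frontier_sub[OF scd] by blast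
    then show "p t - p (t + pi) \<le> 2 * (c \<bullet> unit_vec t)"
      using support_pt_max[of y "t + pi"]
      by (simp add: p_support_pt[of t] y(2) inner_diff_left unit_vec_minus)
    have "2 *\<^sub>R c - support_pt K (t + pi) \<in> K"
      using fr_in[of "t + pi"] c frontier_sub[OF scd] by blast
    then show "2 * (c \<bullet> unit_vec t) \<le> p t - p (t + pi)"
      using support_pt_max[of "2 *\<^sub>R c - support_pt K (t + pi)" t]
      by (simp add: p_support_pt[of "t + pi"] inner_diff_left unit_vec_minus)
  qed
  then show ?thesis
    by (intro equality_if_odd_part[of "fst c" "snd c" 0 0]) (simp add: unit_vec_def inner_prod_def)
qed

definition series_form :: "(nat \<Rightarrow> real) \<Rightarrow> (nat \<Rightarrow> real) \<Rightarrow> bool" where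
  "series_form a b \<longleftrightarrow> (\<forall>\<theta>.
     (\<lambda>n. if even n \<and> n \<ge> 2 then a n * cos (real n * \<theta>) + b n * sin (real n * \<theta>) else 0)
     sums (p \<theta> - (a 0 + a 1 * cos \<theta> + b 1 * sin \<theta> + a 3 * cos (3 * \<theta>) + b 3 * sin (3 * \<theta>))))"

text \<open>
  The terms of the series have even order, so they do not change under a half turn.  They cancel in
  the difference of the series at \<open>t + pi\<close> and at \<open>t\<close>.
\<close>

lemma equality_if_series_form:
  assumes "series_form a b"
  shows "9 * H0 = H1"
proof (rule equality_if_odd_part)
  fix t
  let ?T = "\<lambda>t n. if even n \<and> n \<ge> 2 then a n * cos (real n * t) + b n * sin (real n * t) else 0"
  note S = assms[unfolded series_form_def, rule_format]
  have T: "?T (t + pi) = ?T t" by (simp add: fun_eq_iff trig_half_turn)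
  have "p (t + pi) - (a 0 + a 1 * cos (t + pi) + b 1 * sin (t + pi) + a 3 * cos (3 * (t + pi)) + b 3 * sin (3 * (t + pi))) =
     p t - (a 0 + a 1 * cos t + b 1 * sin t + a 3 * cos (3 * t) + b 3 * sin (3 * t))"
    by (rule sums_unique2[OF S[of "t + pi", unfolded T] S[of t]])
  moreover have "cos (3 * (t + pi)) = - cos (3 * t)" "sin (3 * (t + pi)) = - sin (3 * t)"
    using trig_half_turn[of 3 t] by simp_all
  ultimately show "p t - p (t + pi) = 2 * (a 1 * cos t + b 1 * sin t + a 3 * cos (3 * t) + b 3 * sin (3 * t))"
    by (simp add: algebra_simps)
qed

text \<open>
  Equality reduces \<open>h\<close> to its third harmonic; what is left is the Fourier series of \<open>g\<close>, which has
  only terms of even order.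
\<close>

lemma series_form_if_equality:
  assumes "9 * H0 = H1"
  shows "\<exists>a b. series_form a b"
proof -
  define a where "a n = (if n = 0 then a0 else if n = 1 then s1 else if n = 3 then fourier_cos h 3 else fourier_cos g n)" for n :: nat
  define b where "b n = (if n = 1 then s2 else if n = 3 then fourier_sin h 3 else fourier_sin g n)" for n :: nat
  have h3: "h t = fourier_cos h 3 * cos (3 * t) + fourier_sin h 3 * sin (3 * t)" for t
    using fun_cong[OF third_harmonic_wirtinger(2)[OF assms], of t] by (simp add: harmonic_def)
  have "series_form a b"
    unfolding series_form_def
  proof
    fix t
    let ?T = "\<lambda>n. if even n \<and> n \<ge> 2 then a n * cos (real n * t) + b n * sin (real n * t) else 0"
    have "?T (Suc n) = harmonic g (Suc n) t" for n
    proof (cases "even (Suc n)")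
      case True
      then have "Suc n \<ge> 2" "Suc n \<noteq> 1" "Suc n \<noteq> 3" by (auto elim: oddE)
      then show ?thesis using True by (simp add: a_def b_def harmonic_def)
    next
      case False
      then show ?thesis using half_periodic_coeff[OF g.cont g_half_turn(1)] by (simp add: harmonic_def)
    qed
    then have "(\<lambda>n. ?T (Suc n)) sums g t"
      using g.fourier_series[of t] mean_g by (simp add: fourier_cos_def)
    then have "?T sums (g t + ?T 0)" by (rule sums_Suc)
    moreover have "g t = p t - (a 0 + a 1 * cos t + b 1 * sin t + a 3 * cos (3 * t) + b 3 * sin (3 * t))"
      using p_decomp(1)[of t] h3[of t] by (simp add: a_def b_def e_def)
    ultimately show "?T sums (p t - (a 0 + a 1 * cos t + b 1 * sin t + a 3 * cos (3 * t) + b 3 * sin (3 * t)))"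
      by simp
  qed
  then show ?thesis by blast
qed

end

theorem theorem6p11:
  fixes K :: "(real \<times> real) set" and \<gamma> :: "real \<Rightarrow> real \<times> real"
  assumes "strictly_convex_domain K"
    and "oval \<gamma>"
    and "frontier K = path_image \<gamma>"
  shows "(curve_length \<gamma>)\<^sup>2 - 4 * pi * measure lebesgue K - pi * \<bar>CWMS_area \<gamma>\<bar>
           \<ge> 16 * pi * (d2 K (steiner_symmetral K))\<^sup>2 \<and>
         ((curve_length \<gamma>)\<^sup>2 - 4 * pi * measure lebesgue K - pi * \<bar>CWMS_area \<gamma>\<bar>
           = 16 * pi * (d2 K (steiner_symmetral K))\<^sup>2
          \<longleftrightarrow>
          centrally_symmetric (frontier K) \<or>
          (\<exists>a b :: nat \<Rightarrow> real. \<forall>\<theta>.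
             (\<lambda>n. if even n \<and> n \<ge> 2 then a n * cos (real n * \<theta>) + b n * sin (real n * \<theta>) else 0)
             sums (supp_fun (frontier K) \<theta>
                   - (a 0 + a 1 * cos \<theta> + b 1 * sin \<theta> + a 3 * cos (3 * \<theta>) + b 3 * sin (3 * \<theta>)))))"
proof -
  interpret oval_domain K \<gamma> using assms by unfold_locales
  have gap: "2 * pi * (H1 - H0) - 16 * pi * H0 = 2 * pi * (H1 - 9 * H0)"
    by (simp add: algebra_simps)
  have "16 * pi * H0 \<le> 2 * pi * (H1 - H0)"
    using third_harmonic_wirtinger(1) gap by (simp add: mult_le_cancel_left)
  moreover have "2 * pi * (H1 - H0) = 16 * pi * H0 \<longleftrightarrow> 9 * H0 = H1"
    using gap by auto
  moreover have "9 * H0 = H1 \<longleftrightarrow> centrally_symmetric (frontier K) \<or> (\<exists>a b. series_form a b)"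
    using equality_if_centrally_symmetric equality_if_series_form series_form_if_equality by blast
  ultimately show ?thesis
    unfolding deficit_eq d2_H0 series_form_def p_def by simp
qed

end
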